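(* For all fixed integers $d,t\ge 1$ and $p\ge 3$, we have $$R_{d,t}(p;m)=2^{O(m)},$$ that is, there is a constant $C=C(d,t,p)$ such that $R_{d,t}(p;m)\le 2^{Cm}$ for every integer $m\ge 1$.
   Context: Semi-algebraic relations. Let $V$ be a finite set of points in $\mathbb{R}^d$ and let $E\subset\binom{V}{2}$. Then $E$ is a (symmetric) semi-algebraic relation on $V$ of complexity at most $t$ if there are polynomials $g_1,\dots,g_s\in\mathbb{R}[x_1,\dots,x_{2d}]$ with $s\le t$, each of degree at most $t$, and a Boolean formula $\Phi$ such that for all distinct $u,v\in V$, $$uv\in E\iff \Phi\big(g_1(u,v)\ge 0;\dots;g_s(u,v)\ge 0\big)=1,$$ where $uv=\{u,v\}$, and in $g_\ell(u,v)$ the variables $x_1,\dots,x_d$ are replaced by the coordinates of $u$ and $x_{d+1},\dots,x_{2d}$ by the coordinates of $v$. The relation defined by $\Phi$ and the $g_\ell$ is assumed to be symmetric: for all $u,v\in\mathbb{R}^d$, the right-hand side holds for $(u,v)$ if and only if it holds for $(v,u)$. Ramsey number. $R_{d,t}(p;m)$ is the minimum $n$ such that for every $n$-element point set $V\subset\mathbb{R}^d$ and all semi-algebraic relations $E_1,\dots,E_m\subset\binom{V}{2}$ on $V$, each of complexity at most $t$, with $E_1\cup\dots\cup E_m=\binom{V}{2}$ (the $E_k$ need not be disjoint), there is a subset $S\subset V$ of size $p$ with $\binom{S}{2}\subset E_k$ for some $k\in\{1,\dots,m\}$. *)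

theory Defs
  imports "HOL-Analysis.Analysis" "HOL-Library.Ramsey" "HOL-Library.Poly_Mapping"
begin

text \<open>Real polynomials in variables indexed by a type are represented as finitely supported
  maps from monomials (finitely supported exponent vectors) to coefficients.\<close>

type_synonym 'v mpoly = "('v \<Rightarrow>\<^sub>0 nat) \<Rightarrow>\<^sub>0 real"

definition eval_mpoly :: "'v mpoly \<Rightarrow> ('v \<Rightarrow> real) \<Rightarrow> real" where
  "eval_mpoly g x =
    (\<Sum>a\<in>Poly_Mapping.keys g. Poly_Mapping.lookup g a *
      (\<Prod>i\<in>Poly_Mapping.keys a. x i ^ Poly_Mapping.lookup a i))"

text \<open>The zero polynomial gets total degree 0.\<close>

definition total_degree :: "'v mpoly \<Rightarrow> nat" where
  "total_degree g =
    Max (insert 0 ((\<lambda>a. \<Sum>i\<in>Poly_Mapping.keys a. Poly_Mapping.lookup a i) ` Poly_Mapping.keys g))"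

text \<open>A polynomial in \<open>2d\<close> variables is indexed by \<^typ>\<open>'d + 'd\<close> with \<open>d = CARD('d)\<close>: the
  variables \<^term>\<open>Inl i\<close> play the role of $x_1,\dots,x_d$ and the variables \<^term>\<open>Inr i\<close> that of
  $x_{d+1},\dots,x_{2d}$.\<close>

definition eval_pair :: "('d::finite + 'd) mpoly \<Rightarrow> real^'d \<Rightarrow> real^'d \<Rightarrow> real" where
  "eval_pair g u v = eval_mpoly g (case_sum (\<lambda>i. u $ i) (\<lambda>i. v $ i))"

datatype (atoms: 'a) boolean_formula =
    Const bool
  | Atom 'a
  | Neg "'a boolean_formula"
  | Conj "'a boolean_formula" "'a boolean_formula"
  | Disj "'a boolean_formula" "'a boolean_formula"

primrec eval_formula :: "'a boolean_formula \<Rightarrow> ('a \<Rightarrow> bool) \<Rightarrow> bool" where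
  "eval_formula (Const b) \<sigma> \<longleftrightarrow> b"
| "eval_formula (Atom a) \<sigma> \<longleftrightarrow> \<sigma> a"
| "eval_formula (Neg \<phi>) \<sigma> \<longleftrightarrow> \<not> eval_formula \<phi> \<sigma>"
| "eval_formula (Conj \<phi> \<psi>) \<sigma> \<longleftrightarrow> eval_formula \<phi> \<sigma> \<and> eval_formula \<psi> \<sigma>"
| "eval_formula (Disj \<phi> \<psi>) \<sigma> \<longleftrightarrow> eval_formula \<phi> \<sigma> \<or> eval_formula \<psi> \<sigma>"

definition sign_relation ::
  "('d::finite + 'd) mpoly list \<Rightarrow> nat boolean_formula \<Rightarrow> real^'d \<Rightarrow> real^'d \<Rightarrow> bool" where
  "sign_relation gs \<Phi> u v \<longleftrightarrow> eval_formula \<Phi> (\<lambda>l. eval_pair (gs ! l) u v \<ge> 0)"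

text \<open>The symmetry condition ranges over the whole space, not only over \<open>V\<close>.\<close>

definition semialgebraic_relation ::
  "nat \<Rightarrow> (real^'d::finite) set \<Rightarrow> (real^'d) set set \<Rightarrow> bool" where
  "semialgebraic_relation t V E \<longleftrightarrow>
    E \<subseteq> [V]\<^bsup>2\<^esup> \<and>
    (\<exists>gs \<Phi>. length gs \<le> t \<and> (\<forall>g\<in>set gs. total_degree g \<le> t) \<and>
      atoms \<Phi> \<subseteq> {..<length gs} \<and>
      (\<forall>u v. sign_relation gs \<Phi> u v \<longleftrightarrow> sign_relation gs \<Phi> v u) \<and>
      (\<forall>u\<in>V. \<forall>v\<in>V. u \<noteq> v \<longrightarrow> ({u, v} \<in> E \<longleftrightarrow> sign_relation gs \<Phi> u v)))"

text \<open>The ambient space is \<^typ>\<open>real^'d\<close>, so \<open>d = CARD('d)\<close> is passed as a type argument.\<close>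

definition semialgebraic_arrow :: "'d::finite itself \<Rightarrow> nat \<Rightarrow> nat \<Rightarrow> nat \<Rightarrow> nat \<Rightarrow> bool" where
  "semialgebraic_arrow _ t p m n \<longleftrightarrow>
    (\<forall>(V :: (real^'d) set) (E :: nat \<Rightarrow> (real^'d) set set).
      finite V \<longrightarrow> card V = n \<longrightarrow>
      (\<forall>k\<in>{1..m}. semialgebraic_relation t V (E k)) \<longrightarrow>
      (\<Union>k\<in>{1..m}. E k) = [V]\<^bsup>2\<^esup> \<longrightarrow>
      (\<exists>S k. S \<subseteq> V \<and> card S = p \<and> k \<in> {1..m} \<and> [S]\<^bsup>2\<^esup> \<subseteq> E k))"

definition semialgebraic_ramsey :: "'d::finite itself \<Rightarrow> nat \<Rightarrow> nat \<Rightarrow> nat \<Rightarrow> nat" where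
  "semialgebraic_ramsey D t p m = (LEAST n. semialgebraic_arrow D t p m n)"

text \<open>The minimum is attained, so the use of \<open>LEAST\<close> is unproblematic.\<close>

lemma ex_semialgebraic_arrow:
  assumes "m \<ge> 1"
  shows "\<exists>n. semialgebraic_arrow TYPE('d::finite) t p m n"
proof -
  obtain N :: nat where N: "partn_lst {..<N} (replicate m p) 2"
    using ramsey_full by blast
  have "semialgebraic_arrow TYPE('d) t p m N"
    unfolding semialgebraic_arrow_def
  proof (intro allI impI)
    fix V :: "(real^'d) set" and E :: "nat \<Rightarrow> (real^'d) set set"
    assume V: "finite V" "card V = N" and E: "(\<Union>k\<in>{1..m}. E k) = [V]\<^bsup>2\<^esup>"
    obtain h where h: "bij_betw h {..<N} V"
      using V by (metis bij_betw_iff_card finite_lessThan card_lessThan)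
    define f where "f X = (SOME i. i < m \<and> h ` X \<in> E (Suc i))" for X
    have f: "f X < m \<and> h ` X \<in> E (Suc (f X))" if "X \<in> [{..<N}]\<^bsup>2\<^esup>" for X
    proof -
      have "h ` X \<in> [V]\<^bsup>2\<^esup>"
        using bij_betw_nsets[OF h] that by (auto simp: bij_betw_def)
      then obtain k where "k \<in> {1..m}" "h ` X \<in> E k"
        using E by blast
      then have "k - 1 < m \<and> h ` X \<in> E (Suc (k - 1))"
        by auto
      then show ?thesis
        unfolding f_def by (rule someI)
    qed
    then have "f \<in> [{..<N}]\<^bsup>2\<^esup> \<rightarrow> {..<length (replicate m p)}"
      by auto
    then obtain i H where i: "i < m" and H: "H \<in> [{..<N}]\<^bsup>p\<^esup>" and fH: "f ` [H]\<^bsup>2\<^esup> \<subseteq> {i}"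
      using N unfolding partn_lst_def monochromatic_def by fastforce
    have sub: "H \<subseteq> {..<N}" and cH: "card H = p"
      using H by (auto simp: nsets_def)
    have bH: "bij_betw h H (h ` H)"
      using h sub by (meson bij_betw_subset)
    have "e \<in> E (Suc i)" if e: "e \<in> [h ` H]\<^bsup>2\<^esup>" for e
    proof -
      obtain X where X: "X \<in> [H]\<^bsup>2\<^esup>" "e = h ` X"
        using bij_betw_imp_surj_on[OF bij_betw_nsets[OF bH, of 2]] e by blast
      then have "X \<in> [{..<N}]\<^bsup>2\<^esup>" "f X = i"
        using nsets_mono[OF sub] fH by auto
      then show ?thesis
        using f X by metis
    qed
    moreover have "h ` H \<subseteq> V"
      using h sub by (auto simp: bij_betw_def)
    moreover have "card (h ` H) = p"
      using bij_betw_same_card[OF bH] cH by simp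
    ultimately show "\<exists>S k. S \<subseteq> V \<and> card S = p \<and> k \<in> {1..m} \<and> [S]\<^bsup>2\<^esup> \<subseteq> E k"
      using i by (intro exI[of _ "h ` H"] exI[of _ "Suc i"]) auto
  qed
  then show ?thesis ..
qed

end

theory Submission
  imports Defs
begin

text \<open>The neighbourhoods \<open>N i u\<close>, for all colours \<open>i\<close> and vertices \<open>u\<close> together, belong to one
  family of sets whose numbers of traces and of Venn diagram cells are polynomially bounded,
  independently of the number of colours. By a Haussler type packing argument, for each \<open>\<epsilon>\<close> there is
  a partition of the vertices into polynomially many cells in \<open>1 / \<epsilon>\<close> such that every
  neighbourhood is \<open>\<epsilon>\<close>-close to a union of cells. From this one finds a nonempty set \<open>A\<close> of colours and
  vertices \<open>U i\<close> for \<open>i \<in> A\<close> such that the common neighbourhood of the \<open>U i\<close>, each in its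
  colour \<open>i\<close>, contains at least a proportion \<open>2\<^sup>-\<^sup>C\<^sup>a\<close> of all vertices, where \<open>a\<close> is the size of \<open>A\<close>.
  In this set the clique number of each colour in \<open>A\<close> is smaller, so the sum of all clique numbers
  drops by at least \<open>a\<close>, and induction gives the bound.\<close>

section \<open>Families with polynomially many traces and cells\<close>

text \<open>Add the point \<open>b\<close> to \<open>B\<close>. By convexity, a pattern on \<open>B\<close> that occurs with both signs at \<open>b\<close>
  also occurs for a function vanishing at \<open>b\<close>; these functions are spanned by one generator less.\<close>

lemma card_sign_patterns:
  fixes g :: "'i \<Rightarrow> 'x \<Rightarrow> real"
  assumes "finite B" "finite I"
  shows "card (range (\<lambda>c. {x\<in>B. (\<Sum>i\<in>I. c i * g i x) \<ge> 0})) \<le> (card B + 1) ^ card I"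
  using assms
proof (induction B arbitrary: I g rule: finite_induct)
  case empty
  then show ?case by simp
next
  case (insert b B)
  define f where "f I g c x = (\<Sum>i\<in>I. c i * g i x)" for I :: "'i set" and g :: "'i \<Rightarrow> 'x \<Rightarrow> real" and c x
  define P where "P I g = range (\<lambda>c. {x\<in>B. f I g c x \<ge> 0})" for I g
  \<comment> \<open>Patterns on \<open>B\<close> that extend to \<open>b\<close> with a nonnegative,
    respectively negative, value there. The count is the size of \<open>Q1 \<union> Q0\<close>,
    bounded by induction with the same generators, plus that of \<open>Q1 \<inter> Q0\<close>,
    bounded with one generator less.\<close>
  define Q1 where "Q1 = (\<lambda>c. {x\<in>B. f I g c x \<ge> 0}) ` {c. f I g c b \<ge> 0}"
  define Q0 where "Q0 = (\<lambda>c. {x\<in>B. f I g c x \<ge> 0}) ` {c. f I g c b < 0}"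
  have IH: "card (P I' g') \<le> (card B + 1) ^ card I'" if "finite I'" for I' g'
    using insert.IH[OF that, of g'] by (simp add: P_def f_def)
  have finP: "finite (P I' g')" for I' g'
    by (rule finite_subset[of _ "Pow B"]) (use insert.hyps in \<open>auto simp: P_def\<close>)
  have sub: "Q1 \<union> Q0 \<subseteq> P I g"
    by (auto simp: Q1_def Q0_def P_def)
  have finQ: "finite Q1" "finite Q0"
    using finite_subset[OF sub finP] by auto
  have "range (\<lambda>c. {x\<in>insert b B. f I g c x \<ge> 0}) \<subseteq> insert b ` Q1 \<union> Q0"
  proof (clarify)
    fix c
    assume "{x\<in>insert b B. f I g c x \<ge> 0} \<notin> Q0"
    moreover have "{x\<in>insert b B. f I g c x \<ge> 0} = {x\<in>B. f I g c x \<ge> 0}" if "f I g c b < 0"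
      using that by auto
    ultimately have nonneg: "f I g c b \<ge> 0"
      unfolding Q0_def by (metis (mono_tags, lifting) image_eqI mem_Collect_eq not_less)
    then have "{x\<in>insert b B. f I g c x \<ge> 0} = insert b {x\<in>B. f I g c x \<ge> 0}"
      by auto
    then show "{x\<in>insert b B. f I g c x \<ge> 0} \<in> insert b ` Q1"
      using nonneg by (auto simp: Q1_def)
  qed
  then have "card (range (\<lambda>c. {x\<in>insert b B. f I g c x \<ge> 0})) \<le> card (insert b ` Q1 \<union> Q0)"
    by (intro card_mono) (use finQ in auto)
  also have "\<dots> \<le> card Q1 + card Q0"
    using card_Un_le[of "insert b ` Q1" Q0] card_image_le[OF finQ(1), of "insert b"] by linarith
  also have "\<dots> = card (Q1 \<union> Q0) + card (Q1 \<inter> Q0)"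
    using card_Un_Int finQ by blast
  also have "\<dots> \<le> card (P I g) + card (Q1 \<inter> Q0)"
    using card_mono[OF finP sub] by simp
  finally have main: "card (range (\<lambda>c. {x\<in>insert b B. f I g c x \<ge> 0})) \<le> card (P I g) + card (Q1 \<inter> Q0)" .
  have "card (P I g) + card (Q1 \<inter> Q0) \<le> (card B + 2) ^ card I"
  proof (cases "\<exists>j\<in>I. g j b \<noteq> 0")
    case False
    then have "f I g c b = 0" for c
      by (auto simp: f_def)
    then have "Q0 = {}"
      by (auto simp: Q0_def)
    then show ?thesis
      using IH[OF insert.prems, of g] power_mono[of "card B + 1" "card B + 2" "card I"] by simp
  next
    case True
    then obtain j where j: "j \<in> I" "g j b \<noteq> 0"
      by blast
    \<comment> \<open>The multiple of \<open>g j\<close> is chosen so that every \<open>g' i\<close>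
      vanishes at \<open>b\<close>; functions of the span that vanish at \<open>b\<close> are
      combinations of these.\<close>
    define g' where "g' i x = g i x - g i b / g j b * g j x" for i x
    have "Q1 \<inter> Q0 \<subseteq> P (I - {j}) g'"
    proof
      fix S assume "S \<in> Q1 \<inter> Q0"
      then obtain c c' where c: "f I g c b \<ge> 0" "S = {x\<in>B. f I g c x \<ge> 0}"
        and c': "f I g c' b < 0" "S = {x\<in>B. f I g c' x \<ge> 0}"
        by (auto simp: Q1_def Q0_def)
      \<comment> \<open>With these weights \<open>s * c + r * c'\<close> vanishes at
        \<open>b\<close>, and it keeps the signs on \<open>B\<close> that \<open>c\<close> and
        \<open>c'\<close> share. Since \<open>r\<close> may be 0, strict negativity comes from
        \<open>s > 0\<close>.\<close>
      define s where "s = - f I g c' b"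
      define r where "r = f I g c b"
      have sr: "s > 0" "r \<ge> 0"
        using c c' by (auto simp: s_def r_def)
      define e where "e i = s * c i + r * c' i" for i
      have fe: "f I g e x = s * f I g c x + r * f I g c' x" for x
        by (simp add: f_def e_def sum_distrib_left sum.distrib algebra_simps)
      have e0: "f I g e b = 0"
        unfolding fe by (simp add: s_def r_def)
      have "f I g e x = f (I - {j}) g' e x" for x
      proof -
        have "e j * g j b = - (\<Sum>i\<in>I-{j}. e i * g i b)"
          using e0 sum.remove[OF insert.prems j(1), of "\<lambda>i. e i * g i b"] by (simp add: f_def)
        then have "e j = - (\<Sum>i\<in>I-{j}. e i * g i b) / g j b"
          using j by (simp add: field_simps)
        then have "e j * g j x = - (\<Sum>i\<in>I-{j}. e i * (g i b / g j b * g j x))"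
          by (simp only: sum_divide_distrib sum_distrib_right times_divide_eq_left times_divide_eq_right
              mult_minus_left divide_minus_left mult.assoc)
        then show ?thesis
          using sum.remove[OF insert.prems j(1), of "\<lambda>i. e i * g i x"]
          by (simp add: f_def g'_def right_diff_distrib sum_subtractf)
      qed
      moreover have "S = {x\<in>B. f I g e x \<ge> 0}"
      proof -
        have "f I g e x \<ge> 0" if "f I g c x \<ge> 0" "f I g c' x \<ge> 0" for x
          unfolding fe using that sr by simp
        moreover have "f I g e x < 0" if "f I g c x < 0" "f I g c' x < 0" for x
        proof -
          have "s * f I g c x < 0" "r * f I g c' x \<le> 0"
            using that sr by (auto intro: mult_pos_neg mult_nonneg_nonpos)
          then show ?thesis
            unfolding fe by linarith
        qed
        moreover have "x \<in> B \<Longrightarrow> f I g c x \<ge> 0 \<longleftrightarrow> f I g c' x \<ge> 0" for x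
          using c(2) c'(2) by blast
        ultimately show ?thesis
          unfolding c(2) by (auto simp: not_less[symmetric])
      qed
      ultimately show "S \<in> P (I - {j}) g'"
        by (auto simp: P_def)
    qed
    then have "card (Q1 \<inter> Q0) \<le> (card B + 1) ^ (card I - 1)"
      using card_mono[OF finP[of "I - {j}" g']] IH[of "I - {j}" g'] insert.prems j
      by (simp add: card_Diff_singleton) (meson order_trans)
    moreover have "(card B + 1) ^ card I + (card B + 1) ^ (card I - 1) \<le> (card B + 2) ^ card I"
    proof -
      obtain k where k: "card I = Suc k"
        using j insert.prems by (metis card_gt_0_iff empty_iff gr0_implies_Suc)
      have "(card B + 1) ^ Suc k + (card B + 1) ^ k = (card B + 2) * (card B + 1) ^ k"
        by simp
      also have "\<dots> \<le> (card B + 2) * (card B + 2) ^ k"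
        by (intro mult_le_mono power_mono) auto
      finally show ?thesis
        by (simp add: k)
    qed
    ultimately show ?thesis
      using IH[OF insert.prems, of g] by linarith
  qed
  with main show ?case
    using insert.hyps by (simp add: f_def)
qed

text \<open>Polynomial bounds on the shatter function, which limits the size of packings, and on the
  dual shatter function, which limits the number of cells.\<close>

definition poly_shatter :: "nat \<Rightarrow> nat \<Rightarrow> 'a set set \<Rightarrow> bool" where
  "poly_shatter K D F \<longleftrightarrow>
    (\<forall>X. finite X \<longrightarrow> card ((\<inter>) X ` F) \<le> K * (card X + 1) ^ D) \<and>
    (\<forall>G\<subseteq>F. finite G \<longrightarrow> card (range (\<lambda>v. {S\<in>G. v \<in> S})) \<le> K * (card G + 1) ^ D)"

text \<open>Boolean combinations of \<open>T\<close> sign conditions on functions from one fixed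
  span; the set \<open>\<Psi>\<close> of accepted sign patterns plays the role of the
  formula.\<close>

definition sign_sets :: "nat \<Rightarrow> 'i set \<Rightarrow> ('i \<Rightarrow> 'a \<Rightarrow> real) \<Rightarrow> 'a set set" where
  "sign_sets T I \<phi> =
    {S. \<exists>\<Psi> c. S = {v. {l\<in>{..<T}. (\<Sum>i\<in>I. c l i * \<phi> i v) \<ge> 0} \<in> \<Psi>}}"

text \<open>A trace on \<open>X\<close> is determined by \<open>\<Psi>\<close> and \<open>T\<close>
  sign patterns on \<open>X\<close>. For cells the roles are exchanged: the expressions are bilinear
  in \<open>c\<close> and \<open>\<phi>\<close>, so the numbers \<open>\<phi> i v\<close> serve as
  coefficients and the \<open>c\<close> as functions on pairs of a set and an index.\<close>

lemma poly_shatter_sign_sets: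
  fixes \<phi> :: "'i \<Rightarrow> 'a \<Rightarrow> real"
  assumes "finite I"
  shows "\<exists>K D. poly_shatter K D (sign_sets T I \<phi>)"
proof -
  let ?K = "2 ^ 2 ^ T * (T + 1) ^ card I" and ?D = "card I * T + card I"
  have "card ((\<inter>) X ` sign_sets T I \<phi>) \<le> ?K * (card X + 1) ^ ?D" if "finite X" for X
  proof -
    define P where "P = range (\<lambda>c. {v\<in>X. (\<Sum>i\<in>I. c i * \<phi> i v) \<ge> 0})"
    have P: "finite P" "card P \<le> (card X + 1) ^ card I"
      using card_sign_patterns[OF that assms, of \<phi>] finite_subset[of P "Pow X"] that
      by (auto simp: P_def)
    define h where "h = (\<lambda>(\<Psi>, p). {v\<in>X. {l\<in>{..<T}. v \<in> p l} \<in> \<Psi>})"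
    have "(\<inter>) X ` sign_sets T I \<phi> \<subseteq> h ` (Pow (Pow {..<T}) \<times> ({..<T} \<rightarrow>\<^sub>E P))"
    proof clarify
      fix S assume "S \<in> sign_sets T I \<phi>"
      then obtain \<Psi> c where S: "S = {v. {l\<in>{..<T}. (\<Sum>i\<in>I. c l i * \<phi> i v) \<ge> 0} \<in> \<Psi>}"
        by (auto simp: sign_sets_def)
      define p where "p = (\<lambda>l\<in>{..<T}. {v\<in>X. (\<Sum>i\<in>I. c l i * \<phi> i v) \<ge> 0})"
      have "{l\<in>{..<T}. v \<in> p l} = {l\<in>{..<T}. (\<Sum>i\<in>I. c l i * \<phi> i v) \<ge> 0}" if "v \<in> X" for v
        using that by (auto simp: p_def)
      \<comment> \<open>Only subsets of \<open>{..<T}\<close> are ever tested, so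
        \<open>\<Psi>\<close> may be cut down to one of finitely many sets.\<close>
      then have "X \<inter> S = h (\<Psi> \<inter> Pow {..<T}, p)"
        by (auto simp: S h_def)
      moreover have "p \<in> {..<T} \<rightarrow>\<^sub>E P"
        by (auto simp: p_def P_def)
      ultimately show "X \<inter> S \<in> h ` (Pow (Pow {..<T}) \<times> ({..<T} \<rightarrow>\<^sub>E P))"
        by blast
    qed
    then have "card ((\<inter>) X ` sign_sets T I \<phi>) \<le> card (Pow (Pow {..<T}) \<times> ({..<T} \<rightarrow>\<^sub>E P))"
      using P(1) by (intro surj_card_le) (auto intro!: finite_PiE)
    also have "\<dots> = 2 ^ 2 ^ T * card P ^ T"
      by (simp add: card_cartesian_product card_Pow card_funcsetE)
    also have "\<dots> \<le> 2 ^ 2 ^ T * ((card X + 1) ^ card I) ^ T"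
      using P(2) by (intro mult_le_mono power_mono) auto
    also have "\<dots> = 2 ^ 2 ^ T * (card X + 1) ^ (card I * T)"
      by (simp add: power_mult)
    also have "\<dots> \<le> ?K * (card X + 1) ^ ?D"
      by (intro mult_le_mono power_increasing) auto
    finally show ?thesis .
  qed
  moreover have "card (range (\<lambda>v. {S\<in>G. v \<in> S})) \<le> ?K * (card G + 1) ^ ?D"
    if G: "G \<subseteq> sign_sets T I \<phi>" "finite G" for G
  proof -
    have "\<forall>S\<in>G. \<exists>y. S = {v. {l\<in>{..<T}. (\<Sum>i\<in>I. snd y l i * \<phi> i v) \<ge> 0} \<in> fst y}"
      using G by (auto simp: sign_sets_def)
    then obtain y where y: "\<forall>S\<in>G. S = {v. {l\<in>{..<T}. (\<Sum>i\<in>I. snd (y S) l i * \<phi> i v) \<ge> 0} \<in> fst (y S)}"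
      by (rule bchoice[THEN exE])
    define \<Psi> c where "\<Psi> S = fst (y S)" and "c S = snd (y S)" for S
    have S: "S = {v. {l\<in>{..<T}. (\<Sum>i\<in>I. c S l i * \<phi> i v) \<ge> 0} \<in> \<Psi> S}" if "S \<in> G" for S
      unfolding \<Psi>_def c_def using that y by (rule bspec[rotated])
    define P where "P = range (\<lambda>b. {x\<in>G\<times>{..<T}. (\<Sum>i\<in>I. b i * c (fst x) (snd x) i) \<ge> 0})"
    define h where "h = (\<lambda>p. {S\<in>G. {l\<in>{..<T}. (S, l) \<in> p} \<in> \<Psi> S})"
    have P: "finite P" "card P \<le> (card (G \<times> {..<T}) + 1) ^ card I"
      using card_sign_patterns[of "G \<times> {..<T}" I "\<lambda>i x. c (fst x) (snd x) i"] assms G(2)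
        finite_subset[of P "Pow (G \<times> {..<T})"]
      by (auto simp: P_def)
    have "range (\<lambda>v. {S\<in>G. v \<in> S}) \<subseteq> h ` P"
    proof clarify
      fix v
      let ?p = "{x\<in>G\<times>{..<T}. (\<Sum>i\<in>I. \<phi> i v * c (fst x) (snd x) i) \<ge> 0}"
      have "(v \<in> S) = ({l\<in>{..<T}. (S, l) \<in> ?p} \<in> \<Psi> S)" if "S \<in> G" for S
      proof -
        have "{l\<in>{..<T}. (S, l) \<in> ?p} = {l\<in>{..<T}. (\<Sum>i\<in>I. c S l i * \<phi> i v) \<ge> 0}"
          using that by (auto simp: mult.commute)
        then show ?thesis
          by (subst S[OF that]) simp
      qed
      then have "{S\<in>G. v \<in> S} = h ?p"
        by (auto simp: h_def)
      then show "{S\<in>G. v \<in> S} \<in> h ` P"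
        by (auto simp: P_def)
    qed
    then have "card (range (\<lambda>v. {S\<in>G. v \<in> S})) \<le> card P"
      by (rule surj_card_le[OF P(1)])
    also have "\<dots> \<le> (card G * T + 1) ^ card I"
      using P(2) by (simp add: card_cartesian_product)
    also have "\<dots> \<le> ((T + 1) * (card G + 1)) ^ card I"
      by (intro power_mono) (auto simp: algebra_simps)
    also have "\<dots> = 1 * (T + 1) ^ card I * (card G + 1) ^ card I"
      by (simp only: power_mult_distrib mult_1)
    also have "\<dots> \<le> ?K * (card G + 1) ^ ?D"
      by (intro mult_le_mono power_increasing) auto
    finally show ?thesis .
  qed
  ultimately show ?thesis
    unfolding poly_shatter_def by blast
qed

section \<open>Packing and regular partitions\<close>

text \<open>For \<open>B = 2 ^ (2 * b)\<close> the left side is 2 to a power linear in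
  \<open>b\<close>, while the right side is doubly exponential in \<open>b\<close>.\<close>

lemma exponential_exceeds_power:
  fixes K D :: nat
  shows "\<exists>B>0. K * (4 * B) ^ D * 4 ^ D < 2 ^ B"
proof -
  define c where "c = K + 4 * D"
  define b where "b = c + 2 * D + 1"
  have "c + 2 * b * D < (b + 1) * (b + 1)"
    by (simp add: b_def algebra_simps)
  also have "\<dots> \<le> 2 ^ b * 2 ^ b"
    by (intro mult_le_mono) (simp_all add: Suc_le_eq less_exp)
  finally have *: "c + 2 * b * D < 2 ^ (2 * b)"
    by (simp add: mult_2 power_add)
  have "K * (4 * 2 ^ (2 * b)) ^ D * 4 ^ D = K * 2 ^ (4 * D + 2 * b * D)"
  proof -
    have "(4 :: nat) ^ D = 2 ^ (2 * D)"
      by (simp add: power_mult)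
    moreover have "4 * D + 2 * b * D = 2 * D + 2 * b * D + 2 * D"
      by simp
    ultimately show ?thesis
      by (simp add: power_mult_distrib power_add flip: power_mult) (simp flip: power_add)
  qed
  also have "\<dots> \<le> 2 ^ K * 2 ^ (4 * D + 2 * b * D)"
    by (intro mult_le_mono less_imp_le less_exp) auto
  also have "\<dots> = 2 ^ (c + 2 * b * D)"
    by (simp add: c_def power_add)
  also have "\<dots> < 2 ^ (2 ^ (2 * b))"
    using * by (intro power_strict_increasing) auto
  finally show ?thesis
    by (intro exI[of _ "2 ^ (2 * b)"]) simp
qed

text \<open>Pairwise distance greater than \<open>2^(-h)\<close> in the uniform measure on
  \<open>V\<close>, with denominators cleared.\<close>

definition separated :: "nat \<Rightarrow> 'a set \<Rightarrow> 'a set set \<Rightarrow> bool" where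
  "separated h V G \<longleftrightarrow> (\<forall>S\<in>G. \<forall>S'\<in>G. S \<noteq> S' \<longrightarrow> card V < 2 ^ h * card (V \<inter> sym_diff S S'))"

text \<open>A random tuple of \<open>s\<close> points of \<open>V\<close> distinguishes all pairs of members of \<open>G\<close> with
  positive probability, so the size of \<open>G\<close> is at most polynomial in \<open>s\<close>.\<close>

lemma packing_bound:
  fixes K D :: nat
  shows "\<exists>B. \<forall>h V F (G :: 'a set set). h \<ge> 1 \<longrightarrow> finite V \<longrightarrow> V \<noteq> {} \<longrightarrow>
    poly_shatter K D F \<longrightarrow> G \<subseteq> F \<longrightarrow> finite G \<longrightarrow> separated h V G \<longrightarrow> card G < 2 ^ (B * h)"
proof -
  \<comment> \<open>The factor \<open>K + 1\<close> is positive, so the inequality also yields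
    \<open>4 ^ D \<le> 2 ^ B\<close>, which handles each further unit of \<open>h\<close> at the
    end.\<close>
  obtain B :: nat where B: "B > 0" "(K + 1) * (4 * B) ^ D * 4 ^ D < 2 ^ B"
    using exponential_exceeds_power by blast
  have "card G < 2 ^ (B * h)"
    if h: "h \<ge> 1" and V: "finite V" "V \<noteq> {}" and F: "poly_shatter K D F" "G \<subseteq> F"
      and "finite G" and sep: "separated h V G" for h V F and G :: "'a set set"
  proof (rule ccontr)
    assume "\<not> card G < 2 ^ (B * h)"
    then obtain G' where G': "G' \<subseteq> G" "card G' = 2 ^ (B * h)" "finite G'"
      by (metis not_less obtain_subset_with_card_n)
    \<comment> \<open>A pair is missed by all \<open>s\<close> points with probability at most
      \<open>(1 - 2^(-h))^s\<close>, hence at most \<open>exp (- 2 * B * h)\<close>. This beats the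
      at most \<open>4^(B * h)\<close> pairs because \<open>e > 2\<close>.\<close>
    define s where "s = 2 ^ (h + 1) * B * h"
    define n where "n = card V"
    have n: "n > 0"
      using V by (simp add: n_def card_gt_0_iff)
    define bad where "bad = (\<lambda>(S, S'). {..<s} \<rightarrow>\<^sub>E (V - sym_diff S S'))"
    define pairs where "pairs = {(S, S') \<in> G' \<times> G'. S \<noteq> S'}"
    have pairs: "finite pairs" "card pairs \<le> 2 ^ (B * h) * 2 ^ (B * h)"
    proof -
      have "pairs \<subseteq> G' \<times> G'" by (auto simp: pairs_def)
      then show "finite pairs" "card pairs \<le> 2 ^ (B * h) * 2 ^ (B * h)"
        using G' card_mono[of "G' \<times> G'" pairs] finite_subset[of pairs "G' \<times> G'"]
        by (auto simp: card_cartesian_product)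
    qed
    have bad: "real (card (bad x)) \<le> real n ^ s * exp (- 2 * real B * real h)" if "x \<in> pairs" for x
    proof -
      obtain S S' where "x = (S, S')"
        by (cases x)
      then have x: "x = (S, S')" "S \<in> G" "S' \<in> G" "S \<noteq> S'"
        using that G'(1) by (auto simp: pairs_def)
      define W where "W = V \<inter> sym_diff S S'"
      have W: "n < 2 ^ h * card W"
        using sep x by (simp add: separated_def W_def n_def)
      have "V - sym_diff S S' = V - W"
        by (auto simp: W_def)
      then have "card (V - sym_diff S S') = n - card W" "card W \<le> n"
        using V by (auto simp: card_Diff_subset W_def n_def card_mono)
      then have "real (card (V - sym_diff S S')) = real n - real (card W)"
        by simp
      moreover have "real (card W) \<ge> n / 2 ^ h"
        using of_nat_mono[OF less_imp_le[OF W], where 'a = real] by (simp add: field_simps)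
      ultimately have "real (card (V - sym_diff S S')) \<le> real n * (1 - 1 / 2 ^ h)"
        by (simp add: algebra_simps)
      also have "\<dots> \<le> real n * exp (- 1 / 2 ^ h)"
        using exp_ge_add_one_self[of "- 1 / 2 ^ h"] by (intro mult_left_mono) auto
      finally have "real (card (V - sym_diff S S')) ^ s \<le> (real n * exp (- 1 / 2 ^ h)) ^ s"
        by (intro power_mono) (use \<open>card W \<le> n\<close> in auto)
      also have "\<dots> = real n ^ s * exp (- (real s / 2 ^ h))"
        by (simp add: power_mult_distrib exp_of_nat_mult[symmetric])
      also have "real s / 2 ^ h = 2 * real B * real h"
        by (simp add: s_def)
      finally show ?thesis
        by (simp add: x bad_def card_funcsetE)
    qed
    have "\<not> ({..<s} \<rightarrow>\<^sub>E V) \<subseteq> (\<Union>x\<in>pairs. bad x)"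
    proof
      assume "({..<s} \<rightarrow>\<^sub>E V) \<subseteq> (\<Union>x\<in>pairs. bad x)"
      then have "card ({..<s} \<rightarrow>\<^sub>E V) \<le> card (\<Union>x\<in>pairs. bad x)"
        using V pairs by (intro card_mono) (auto simp: bad_def intro!: finite_PiE)
      also have "\<dots> \<le> (\<Sum>x\<in>pairs. card (bad x))"
        using pairs by (intro card_UN_le)
      finally have "n ^ s \<le> (\<Sum>x\<in>pairs. card (bad x))"
        by (simp add: card_funcsetE n_def)
      then have "real n ^ s \<le> real (\<Sum>x\<in>pairs. card (bad x))"
        by (metis of_nat_le_iff of_nat_power)
      also have "\<dots> \<le> card pairs * (real n ^ s * exp (- 2 * real B * real h))"
        unfolding of_nat_sum using bad by (intro sum_bounded_above) auto
      also have "\<dots> \<le> (2 ^ (B * h) * 2 ^ (B * h)) * (real n ^ s * exp (- 2 * real B * real h))"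
        using pairs(2) by (intro mult_right_mono)
          (auto simp: of_nat_le_iff[symmetric, where 'a = real] simp del: of_nat_le_iff)
      also have "\<dots> = real n ^ s * (2 ^ (B * h) * exp (- (real B * real h))) ^ 2"
        by (simp add: power2_eq_square mult_exp_exp algebra_simps)
      also have "\<dots> < real n ^ s * 1"
      proof (intro mult_strict_left_mono)
        have "exp (1 :: real) > 2"
          using exp_lower_Taylor_quadratic[of 1] by simp
        then have "2 ^ (B * h) < exp (1 :: real) ^ (B * h)"
          using B(1) h by (intro power_strict_mono) auto
        then have "2 ^ (B * h) * exp (- (real B * real h)) < 1"
          by (simp add: exp_minus field_simps flip: exp_of_nat_mult of_nat_mult)
        then show "(2 ^ (B * h) * exp (- (real B * real h))) ^ 2 < 1"
          by (simp add: power_less_one_iff abs_square_less_1)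
      qed (use n in auto)
      finally show False by simp
    qed
    then obtain x where x: "x \<in> {..<s} \<rightarrow>\<^sub>E V" "\<And>y. y \<in> pairs \<Longrightarrow> x \<notin> bad y"
      by blast
    define X where "X = x ` {..<s}"
    have X: "finite X" "card X \<le> s"
      using card_image_le[of "{..<s}" x] by (auto simp: X_def)
    \<comment> \<open>The members of \<open>G'\<close> thus have distinct traces on
      \<open>X\<close>, whose number is polynomial in \<open>s\<close>; the choice of
      \<open>B\<close> makes this too small.\<close>
    have "inj_on ((\<inter>) X) G'"
    proof (rule inj_onI, rule ccontr)
      fix S S' assume S: "S \<in> G'" "S' \<in> G'" "X \<inter> S = X \<inter> S'" "S \<noteq> S'"
      then have "x \<notin> {..<s} \<rightarrow>\<^sub>E (V - sym_diff S S')"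
        using x(2)[of "(S, S')"] by (auto simp: pairs_def bad_def)
      then obtain l where "l < s" "x l \<in> sym_diff S S'"
        using x(1) by (auto simp: PiE_iff)
      then show False
        using S(3) by (auto simp: X_def)
    qed
    then have "2 ^ (B * h) = card ((\<inter>) X ` G')"
      using G' by (simp add: card_image)
    also have "\<dots> \<le> card ((\<inter>) X ` F)"
      using G' F finite_subset[of "(\<inter>) X ` F" "Pow X"] X by (intro card_mono) auto
    also have "\<dots> \<le> K * (card X + 1) ^ D"
      using F X unfolding poly_shatter_def by blast
    also have "\<dots> \<le> (K + 1) * (4 * B * 4 ^ h) ^ D"
    proof (intro mult_le_mono power_mono)
      have "card X + 1 \<le> 2 * 2 ^ h * B * h + 1"
        using X by (simp add: s_def)
      also have "\<dots> \<le> 2 * 2 ^ h * B * 2 ^ h + 1"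
        by (intro add_le_mono mult_le_mono) (auto simp: less_imp_le less_exp)
      also have "\<dots> = 2 * B * (2 * 2) ^ h + 1"
        by (simp only: power_mult_distrib ac_simps)
      also have "\<dots> = 2 * B * 4 ^ h + 1"
        by simp
      also have "\<dots> \<le> 4 * B * 4 ^ h"
        using B(1) by (simp add: Suc_le_eq)
      finally show "card X + 1 \<le> 4 * B * 4 ^ h" .
    qed auto
    also have "\<dots> = (K + 1) * (4 * B) ^ D * 4 ^ D * (4 ^ D) ^ (h - 1)"
    proof -
      have *: "(4 ^ h) ^ D = (4 :: nat) ^ D * (4 ^ D) ^ (h - 1)"
        using h by (cases h) (auto simp: power_mult_distrib mult.commute simp flip: power_mult)
      show ?thesis
        by (simp only: power_mult_distrib mult.assoc *)
    qed
    also have "\<dots> < 2 ^ B * (2 ^ B) ^ (h - 1)"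
    proof (intro mult_less_le_imp_less power_mono B(2))
      have "1 * 4 ^ D \<le> (K + 1) * (4 * B) ^ D * 4 ^ D"
        using B(1) by (intro mult_le_mono1) (auto simp: Suc_le_eq)
      then show "4 ^ D \<le> (2 :: nat) ^ B"
        using B(2) by linarith
    qed auto
    also have "\<dots> = 2 ^ (B * h)"
      using h by (cases h) (auto simp: power_mult power_add)
    finally show False by simp
  qed
  then show ?thesis by blast
qed

text \<open>The cells are the atoms of the Venn diagram of a maximal separated subfamily.\<close>

lemma regular_partition:
  fixes K D :: nat
  shows "\<exists>B. \<forall>h V (F :: 'a set set). h \<ge> 1 \<longrightarrow> finite V \<longrightarrow> V \<noteq> {} \<longrightarrow> poly_shatter K D F \<longrightarrow>
    (\<exists>cell :: 'a \<Rightarrow> 'a set set. card (cell ` V) \<le> 2 ^ (B * h) \<and>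
      (\<forall>S\<in>F. \<exists>U\<subseteq>V. (\<forall>u\<in>U. \<forall>v\<in>V. cell v = cell u \<longrightarrow> v \<in> U) \<and>
        2 ^ h * card (V \<inter> sym_diff S U) \<le> card V))"
proof -
  obtain B where B: "\<And>h V F (G :: 'a set set). h \<ge> 1 \<Longrightarrow> finite V \<Longrightarrow> V \<noteq> {} \<Longrightarrow>
    poly_shatter K D F \<Longrightarrow> G \<subseteq> F \<Longrightarrow> finite G \<Longrightarrow> separated h V G \<Longrightarrow> card G < 2 ^ (B * h)"
    using packing_bound by blast
  have "\<exists>cell :: 'a \<Rightarrow> 'a set set. card (cell ` V) \<le> 2 ^ ((K + B * D) * h) \<and>
      (\<forall>S\<in>F. \<exists>U\<subseteq>V. (\<forall>u\<in>U. \<forall>v\<in>V. cell v = cell u \<longrightarrow> v \<in> U) \<and>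
        2 ^ h * card (V \<inter> sym_diff S U) \<le> card V)"
    if h: "h \<ge> 1" and V: "finite V" "V \<noteq> {}" and F: "poly_shatter K D F" for h V F
  proof -
    define P where "P G \<longleftrightarrow> G \<subseteq> F \<and> finite G \<and> separated h V G" for G
    have "P {}"
      by (simp add: P_def separated_def)
    moreover have "\<forall>G. P G \<longrightarrow> card G < 2 ^ (B * h)"
      using B[OF h V F] by (auto simp: P_def)
    ultimately obtain G where G: "P G" and max: "\<And>G'. P G' \<Longrightarrow> card G' \<le> card G"
      using ex_has_greatest_nat[of P "{}" card "2 ^ (B * h)"] by blast
    have G': "G \<subseteq> F" "finite G" "separated h V G" "card G < 2 ^ (B * h)"
      using G B[OF h V F] by (auto simp: P_def)
    define cell where "cell v = {S\<in>G. v \<in> S}" for v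
    have "card (cell ` V) \<le> card (range (\<lambda>v. {S\<in>G. v \<in> S}))"
      using G' finite_subset[of "range (\<lambda>v. {S\<in>G. v \<in> S})" "Pow G"]
      by (intro card_mono) (auto simp: cell_def)
    also have "\<dots> \<le> K * (card G + 1) ^ D"
      using F G' unfolding poly_shatter_def by blast
    also have "\<dots> \<le> 2 ^ (K * h) * (2 ^ (B * h)) ^ D"
    proof (intro mult_le_mono power_mono)
      have "K \<le> 2 ^ K" by (simp add: less_imp_le less_exp)
      also have "\<dots> \<le> 2 ^ (K * h)" using h by (intro power_increasing) auto
      finally show "K \<le> 2 ^ (K * h)" .
    qed (use G' in auto)
    also have "\<dots> = 2 ^ ((K + B * D) * h)"
      by (simp add: algebra_simps flip: power_mult power_add)
    finally have "card (cell ` V) \<le> 2 ^ ((K + B * D) * h)" .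
    moreover have "\<exists>U\<subseteq>V. (\<forall>u\<in>U. \<forall>v\<in>V. cell v = cell u \<longrightarrow> v \<in> U) \<and>
        2 ^ h * card (V \<inter> sym_diff S U) \<le> card V" if S: "S \<in> F" for S
    proof -
      \<comment> \<open>Otherwise \<open>S\<close> could be added to \<open>G\<close>, against
        maximality. The union of cells sought is then \<open>V \<inter> S'\<close>.\<close>
      have "\<exists>S'\<in>G. 2 ^ h * card (V \<inter> sym_diff S S') \<le> card V"
      proof (rule ccontr)
        assume *: "\<not> ?thesis"
        have comm: "sym_diff S' S = sym_diff S S'" for S'
          by blast
        have "S \<notin> G"
          using * by force
        moreover have "P (insert S G)"
          using G' S * by (auto simp: P_def separated_def not_le comm)
        ultimately show False
          using max[of "insert S G"] G' by simp
      qed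
      then obtain S' where S': "S' \<in> G" "2 ^ h * card (V \<inter> sym_diff S S') \<le> card V"
        by blast
      have "V \<inter> sym_diff S (V \<inter> S') = V \<inter> sym_diff S S'"
        by blast
      with S' show ?thesis
        by (intro exI[of _ "V \<inter> S'"]) (auto simp: cell_def)
    qed
    ultimately show ?thesis by blast
  qed
  then show ?thesis by blast
qed

section \<open>Large common neighbourhoods\<close>

lemma card_eq_sum_fibres:
  assumes "finite Y" "finite T" "f ` Y \<subseteq> T"
  shows "card Y = (\<Sum>y\<in>T. card {x\<in>Y. f x = y})"
  using sum.group[OF assms, of "\<lambda>_. 1 :: nat"] by simp

text \<open>The points counted lie in \<open>S - U\<close>, or in a fibre inside \<open>U\<close>
  with at least a proportion \<open>2^(-j-1)\<close> outside \<open>S\<close>. Such fibres together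
  have at most \<open>2^(j+1)\<close> times as many points as \<open>U - S\<close>, so everything is
  at most \<open>2^(j+2)\<close> times the error of \<open>U\<close>.\<close>

lemma card_near_fibre_union:
  fixes f :: "'a \<Rightarrow> 'b"
  defines "Q \<equiv> \<lambda>V v. {w\<in>V. f w = f v}"
  assumes V: "finite V" and U: "U \<subseteq> V" "\<And>u v. u \<in> U \<Longrightarrow> v \<in> V \<Longrightarrow> f v = f u \<Longrightarrow> v \<in> U"
    and h: "2 ^ (3 * j + 8) * card (V \<inter> sym_diff S U) \<le> card V"
  shows "card {v\<in>V. v \<in> S \<and> card (Q V v) < 2 ^ (j + 1) * card (Q V v - S)} * 2 ^ (2 * j + 6) \<le> card V"
proof -
  define Y where "Y = {v\<in>U. card (Q V v) \<le> 2 ^ (j + 1) * card (Q V v - S)}"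
  define Z where "Z = V \<inter> sym_diff S U"
  have fin: "finite Y" "finite Z"
    using V U by (auto simp: Y_def Z_def intro: finite_subset)
  \<comment> \<open>\<open>Y\<close> is itself a union of full fibres, as its defining condition
    depends on the fibre only.\<close>
  have Q: "{x\<in>Y. f x = f v} = Q V v" "{x\<in>Y - S. f x = f v} = Q V v - S" if "v \<in> Y" for v
  proof -
    have "w \<in> Y" if w: "w \<in> V" "f w = f v" for w
    proof -
      have "Q V w = Q V v"
        using w by (auto simp: Q_def)
      moreover have "w \<in> U"
        using U w \<open>v \<in> Y\<close> by (auto simp: Y_def)
      ultimately show ?thesis
        using \<open>v \<in> Y\<close> by (simp add: Y_def)
    qed
    moreover have "Y \<subseteq> V"
      using U by (auto simp: Y_def)
    ultimately show "{x\<in>Y. f x = f v} = Q V v" "{x\<in>Y - S. f x = f v} = Q V v - S"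
      by (auto simp: Q_def)
  qed
  have "card Y = (\<Sum>y\<in>f ` Y. card {x\<in>Y. f x = y})"
    by (rule card_eq_sum_fibres) (use fin in auto)
  also have "\<dots> \<le> (\<Sum>y\<in>f ` Y. 2 ^ (j + 1) * card {x\<in>Y - S. f x = y})"
  proof (intro sum_mono, clarify)
    fix v assume v: "v \<in> Y"
    show "card {x\<in>Y. f x = f v} \<le> 2 ^ (j + 1) * card {x\<in>Y - S. f x = f v}"
      unfolding Q[OF v] using v by (simp add: Y_def)
  qed
  also have "\<dots> = 2 ^ (j + 1) * card (Y - S)"
    by (subst card_eq_sum_fibres[of "Y - S" "f ` Y" f]) (use fin in \<open>auto simp: sum_distrib_left\<close>)
  also have "card (Y - S) \<le> card Z"
    by (rule card_mono) (use fin U in \<open>auto simp: Y_def Z_def\<close>)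
  finally have Y: "card Y \<le> 2 ^ (j + 1) * card Z"
    by simp
  have "{v\<in>V. v \<in> S \<and> card (Q V v) < 2 ^ (j + 1) * card (Q V v - S)} \<subseteq> Z \<union> Y"
    by (auto simp: Z_def Y_def)
  then have "card {v\<in>V. v \<in> S \<and> card (Q V v) < 2 ^ (j + 1) * card (Q V v - S)} \<le> card (Z \<union> Y)"
    by (rule card_mono[rotated]) (use fin in auto)
  also have "\<dots> \<le> 1 * card Z + 2 ^ (j + 1) * card Z"
    using card_Un_le[of Z Y] Y by linarith
  also have "\<dots> \<le> 2 ^ (j + 1) * card Z + 2 ^ (j + 1) * card Z"
    by (intro add_mono mult_le_mono) auto
  also have "\<dots> = 2 ^ (j + 2) * card Z"
    by simp
  finally have "card {v\<in>V. v \<in> S \<and> card (Q V v) < 2 ^ (j + 1) * card (Q V v - S)} * 2 ^ (2 * j + 6)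
      \<le> 2 ^ (j + 2) * card Z * 2 ^ (2 * j + 6)"
    by (rule mult_le_mono1)
  also have "\<dots> = 2 ^ ((j + 2) + (2 * j + 6)) * card Z"
    by (simp only: power_add ac_simps)
  also have "(j + 2) + (2 * j + 6) = 3 * j + 8"
    by simp
  finally show ?thesis
    using h by (simp add: Z_def)
qed

lemma card_small_fibres:
  assumes "finite V" "\<And>v. v \<in> Y \<Longrightarrow> card {w\<in>V. f w = f v} * b \<le> n" "Y \<subseteq> V"
  shows "card Y * b \<le> card (f ` V) * n"
proof -
  have "finite Y"
    using assms finite_subset by blast
  have "card Y * b = (\<Sum>y\<in>f ` Y. card {x\<in>Y. f x = y} * b)"
    by (subst card_eq_sum_fibres[of Y "f ` Y" f]) (use \<open>finite Y\<close> in \<open>auto simp: sum_distrib_right\<close>)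
  also have "\<dots> \<le> (\<Sum>y\<in>f ` Y. n)"
  proof (intro sum_mono, clarify)
    fix v assume v: "v \<in> Y"
    have "card {x\<in>Y. f x = f v} * b \<le> card {w\<in>V. f w = f v} * b"
      using assms by (intro mult_le_mono1 card_mono) auto
    then show "card {x\<in>Y. f x = f v} * b \<le> n"
      using assms(2)[OF v] by linarith
  qed
  also have "\<dots> = card (f ` Y) * n"
    by simp
  also have "\<dots> \<le> card (f ` V) * n"
    using assms by (intro mult_le_mono1 card_mono) auto
  finally show ?thesis .
qed

text \<open>Double counting over disjoint sets. It is applied with \<open>b = 2 ^ j\<close> to the
  colour classes at a single vertex.\<close>

lemma card_heavy_colours:
  fixes X :: "'c \<Rightarrow> 'a set"
  assumes "finite V" "V \<noteq> {}" "finite H" "disjoint_family_on X H"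
    and "\<And>i. i \<in> H \<Longrightarrow> X i \<subseteq> V \<and> card V \<le> b * card (X i)"
  shows "card H \<le> b"
proof -
  have "card H * card V = (\<Sum>i\<in>H. card V)"
    by simp
  also have "\<dots> \<le> (\<Sum>i\<in>H. b * card (X i))"
    using assms by (intro sum_mono) auto
  also have "\<dots> = b * card (\<Union>i\<in>H. X i)"
  proof -
    have "finite (X i)" if "i \<in> H" for i
      using assms(1,5) that finite_subset by metis
    then have "card (\<Union>i\<in>H. X i) = (\<Sum>i\<in>H. card (X i))"
      using assms(3,4) by (intro card_UN_disjoint) (auto simp: disjoint_family_on_def)
    then show ?thesis
      by (simp add: sum_distrib_left)
  qed
  also have "\<dots> \<le> b * card V"
    using assms by (intro mult_le_mono2 card_mono) auto
  finally show ?thesis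
    using assms by (simp add: card_gt_0_iff)
qed

text \<open>The least \<open>j\<close> with \<open>n \<le> 2 ^ j * a\<close> works:
  \<open>a < n\<close> excludes 0, and \<open>j \<le> n\<close> leaves a finite range of levels to
  sum over.\<close>

lemma dyadic_level:
  fixes a n :: nat
  assumes "1 \<le> a" "a < n"
  shows "\<exists>j\<in>{1..n}. n \<le> 2 ^ j * a \<and> 2 ^ j * a < 2 * n"
proof -
  define j where "j = (LEAST j. n \<le> 2 ^ j * a)"
  have "n \<le> 2 ^ n * 1"
    by (simp add: less_imp_le less_exp)
  also have "\<dots> \<le> 2 ^ n * a"
    using assms by (intro mult_le_mono) auto
  finally have n: "n \<le> 2 ^ n * a" .
  have j: "n \<le> 2 ^ j * a" "j \<le> n"
    unfolding j_def using n by (auto intro: LeastI Least_le)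
  have "j \<noteq> 0"
    using j assms by (cases j) auto
  then obtain k where k: "j = Suc k"
    by (cases j) auto
  then have "\<not> n \<le> 2 ^ k * a"
    using not_less_Least[of k "\<lambda>j. n \<le> 2 ^ j * a"] by (simp add: j_def)
  then show ?thesis
    using j k by (intro bexI[of _ j]) auto
qed

lemma sum_half_powers: "(\<Sum>j=1..n. 1 / 2 ^ j) \<le> (1 :: real)"
proof -
  have "(\<Sum>j=1..n. 1 / 2 ^ j) = 1 - 1 / (2 :: real) ^ n"
    by (induction n) (auto simp: field_simps)
  then show ?thesis by simp
qed

lemma sum_index_half_powers: "(\<Sum>j=1..n. real j / 2 ^ j) \<le> 2"
proof -
  have "(\<Sum>j=1..n. real j / 2 ^ j) = 2 - (real n + 2) / 2 ^ n"
    by (induction n) (auto simp: field_simps)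
  then show ?thesis by simp
qed

text \<open>Orient each edge \<open>uv\<close>, of colour \<open>i\<close> say, so that the colour class \<open>X i u\<close> of \<open>i\<close> at \<open>u\<close>
  is at least as large as \<open>X i v\<close>, and let \<open>2\<^sup>-\<^sup>j\<close> be the order of magnitude of the density of \<open>X i v\<close>.
  Then \<open>N i u\<close> typically contains nearly all of the cell of \<open>v\<close> in the partition of
  accuracy \<open>2\<^sup>-\<^sup>3\<^sup>j\<close>. For some \<open>v\<close> the colours of its typical edges have total density at least 1/8, so for some \<open>j\<close> at
  least \<open>j / 32\<close> colours have level \<open>j\<close>, while the cell has density \<open>2\<^sup>-\<^sup>O\<^sup>(\<^sup>j\<^sup>)\<close>.\<close>

lemma large_common_neighbourhood:
  fixes K D :: nat
  shows "\<exists>C. \<forall>V (F :: 'a set set) M (N :: 'c \<Rightarrow> 'a \<Rightarrow> 'a set). finite V \<longrightarrow> card V \<ge> 2 \<longrightarrow> finite M \<longrightarrow>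
    poly_shatter K D F \<longrightarrow> (\<forall>i\<in>M. \<forall>u\<in>V. N i u \<in> F) \<longrightarrow>
    (\<forall>i\<in>M. \<forall>u\<in>V. \<forall>v\<in>V. v \<in> N i u \<longrightarrow> u \<in> N i v) \<longrightarrow>
    (\<forall>u\<in>V. \<forall>v\<in>V. u \<noteq> v \<longrightarrow> (\<exists>i\<in>M. v \<in> N i u)) \<longrightarrow>
    (\<exists>A U. A \<subseteq> M \<and> A \<noteq> {} \<and> (\<forall>i\<in>A. U i \<in> V) \<and>
      card V \<le> 2 ^ (C * card A) * card {w\<in>V. \<forall>i\<in>A. w \<in> N i (U i)})"
proof -
  obtain B where B: "\<forall>h V (F :: 'a set set). h \<ge> 1 \<longrightarrow> finite V \<longrightarrow> V \<noteq> {} \<longrightarrow> poly_shatter K D F \<longrightarrow>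
    (\<exists>cell :: 'a \<Rightarrow> 'a set set. card (cell ` V) \<le> 2 ^ (B * h) \<and>
      (\<forall>S\<in>F. \<exists>U\<subseteq>V. (\<forall>u\<in>U. \<forall>v\<in>V. cell v = cell u \<longrightarrow> v \<in> U) \<and>
        2 ^ h * card (V \<inter> sym_diff S U) \<le> card V))"
    by (rule regular_partition[of K D, THEN exE])
  \<comment> \<open>The final exponent \<open>B * (3 * j + 8) + j + 5\<close> is at most
    \<open>(11 * B + 6) * j\<close> for \<open>j \<ge> 1\<close>, and \<open>j\<close> is at most 32
    times the number of colours found.\<close>
  define C where "C = 32 * (11 * B + 6)"
  show ?thesis
  proof (intro exI[of _ C] allI impI)
    fix V :: "'a set" and F :: "'a set set" and M and N :: "'c \<Rightarrow> 'a \<Rightarrow> 'a set"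
    assume V: "finite V" "card V \<ge> 2" and M: "finite M" and F: "poly_shatter K D F"
      and NF': "\<forall>i\<in>M. \<forall>u\<in>V. N i u \<in> F"
      and sym': "\<forall>i\<in>M. \<forall>u\<in>V. \<forall>v\<in>V. v \<in> N i u \<longrightarrow> u \<in> N i v"
      and cover': "\<forall>u\<in>V. \<forall>v\<in>V. u \<noteq> v \<longrightarrow> (\<exists>i\<in>M. v \<in> N i u)"
    note NF = NF'[rule_format] and sym = sym'[rule_format] and cover = cover'[rule_format]
    define n where "n = card V"
    have n: "n \<ge> 2" and "V \<noteq> {}"
      using V by (auto simp: n_def)
    have "\<forall>j. \<exists>cell :: 'a \<Rightarrow> 'a set set. card (cell ` V) \<le> 2 ^ (B * (3 * j + 8)) \<and>
      (\<forall>S\<in>F. \<exists>U\<subseteq>V. (\<forall>u\<in>U. \<forall>v\<in>V. cell v = cell u \<longrightarrow> v \<in> U) \<and>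
        2 ^ (3 * j + 8) * card (V \<inter> sym_diff S U) \<le> card V)"
      by (intro allI B[rule_format, OF _ V(1) \<open>V \<noteq> {}\<close> F]) simp
    then obtain cell :: "nat \<Rightarrow> 'a \<Rightarrow> 'a set set"
      where cells: "\<forall>j. card (cell j ` V) \<le> 2 ^ (B * (3 * j + 8)) \<and>
        (\<forall>S\<in>F. \<exists>U\<subseteq>V. (\<forall>u\<in>U. \<forall>v\<in>V. cell j v = cell j u \<longrightarrow> v \<in> U) \<and>
          2 ^ (3 * j + 8) * card (V \<inter> sym_diff S U) \<le> card V)"
      by (rule choice[THEN exE])
    note card_cell = cells[THEN spec, THEN conjunct1]
    note cell = cells[THEN spec, THEN conjunct2, THEN bspec]
    define Q where "Q j v = {w\<in>V. cell j w = cell j v}" for j v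
    have finQ: "finite (Q j v)" for j v
      using V by (simp add: Q_def)

    \<comment> \<open>Fixing one colour per pair makes the classes at a vertex disjoint although the
      relations may overlap. The condition is symmetric in \<open>u\<close> and \<open>v\<close>,
      hence so is the choice.\<close>
    define col where "col u v = (SOME i. i \<in> M \<and> v \<in> N i u \<and> u \<in> N i v)" for u v
    have col: "col u v \<in> M" "v \<in> N (col u v) u" if "u \<in> V" "v \<in> V" "u \<noteq> v" for u v
    proof -
      have "\<exists>i. i \<in> M \<and> v \<in> N i u \<and> u \<in> N i v"
        using cover[OF that] sym that by blast
      from someI_ex[OF this] show "col u v \<in> M" "v \<in> N (col u v) u"
        by (auto simp: col_def)
    qed
    have col_commute: "col u v = col v u" for u v
      unfolding col_def by (rule arg_cong[where f = Eps]) auto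
    define X where "X i u = {v\<in>V. v \<noteq> u \<and> col u v = i}" for i u
    have X: "X i u \<subseteq> V" "finite (X i u)" for i u
      using V by (auto simp: X_def)
    have disj: "disjoint_family_on (\<lambda>i. X i u) H" for u H
      by (auto simp: disjoint_family_on_def X_def)
    define good where "good = {(u, v) \<in> V \<times> V. u \<noteq> v \<and> card (X (col u v) v) \<le> card (X (col u v) u)}"
    have level_ex: "\<exists>j\<in>{1..n}. n \<le> 2 ^ j * card (X (col u v) v) \<and> 2 ^ j * card (X (col u v) v) < 2 * n"
      if "u \<in> V" "v \<in> V" "u \<noteq> v" for u v
    proof (rule dyadic_level)
      have "u \<in> X (col u v) v"
        using that by (auto simp: X_def col_commute)
      then show "1 \<le> card (X (col u v) v)"
        using X by (metis One_nat_def Suc_leI card_gt_0_iff empty_iff)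
      have "X (col u v) v \<subset> V"
        using that by (auto simp: X_def)
      then show "card (X (col u v) v) < n"
        using V by (simp add: n_def psubset_card_mono)
    qed
    define level where "level u v = (SOME j. j \<in> {1..n} \<and>
      n \<le> 2 ^ j * card (X (col u v) v) \<and> 2 ^ j * card (X (col u v) v) < 2 * n)" for u v
    have level: "level u v \<in> {1..n}" "n \<le> 2 ^ level u v * card (X (col u v) v)"
        "2 ^ level u v * card (X (col u v) v) < 2 * n"
      if "u \<in> V" "v \<in> V" "u \<noteq> v" for u v
      using someI_ex[OF level_ex[OF that, unfolded Bex_def]] by (auto simp: level_def)

    \<comment> \<open>Of each pair of distinct vertices at least one orientation is good; ties make
      both good.\<close>
    have good_card: "n * n - n \<le> 2 * card good"
    proof -
      define E where "E = {(u, v) \<in> V \<times> V. u \<noteq> v}"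
      have E: "finite E"
        using V finite_subset[of E "V \<times> V"] by (auto simp: E_def)
      have "V \<times> V = E \<union> (\<lambda>v. (v, v)) ` V"
        by (auto simp: E_def)
      then have "n * n \<le> card E + card ((\<lambda>v. (v, v)) ` V)"
        using card_Un_le[of E "(\<lambda>v. (v, v)) ` V"] by (simp add: n_def card_cartesian_product[symmetric])
      also have "card ((\<lambda>v. (v, v)) ` V) \<le> n"
        using V by (simp add: n_def card_image_le)
      finally have "n * n - n \<le> card E"
        by simp
      moreover have "E \<subseteq> good \<union> prod.swap ` good"
      proof clarify
        fix u v assume uv: "(u, v) \<in> E" "(u, v) \<notin> prod.swap ` good"
        then have "(v, u) \<notin> good"
          by force
        then show "(u, v) \<in> good"
          using uv(1) col_commute[of u v] by (auto simp: E_def good_def)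
      qed
      moreover have fin: "finite good"
        using E finite_subset[of good E] by (auto simp: E_def good_def)
      ultimately have "n * n - n \<le> card (good \<union> prod.swap ` good)"
        by (meson card_mono finite_UnI finite_imageI order_trans)
      also have "\<dots> \<le> card good + card good"
        using card_Un_le[of good "prod.swap ` good"] card_image_le[OF fin, of prod.swap] by linarith
      finally show ?thesis by simp
    qed

    \<comment> \<open>More than a proportion \<open>2^(-j-1)\<close> of the cell of \<open>v\<close>
      lies outside the neighbourhood of \<open>u\<close>, where \<open>j\<close> is the
      level.\<close>
    define bad where "bad = {(u, v) \<in> good. card (Q (level u v) v) <
      2 ^ (level u v + 1) * card (Q (level u v) v - N (col u v) u)}"
    \<comment> \<open>There are at most \<open>2^(B * (3 * j + 8))\<close> cells at level
      \<open>j\<close>, so cells below this threshold cover at most a proportion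
      \<open>2^(-j-4)\<close> of \<open>V\<close>.\<close>
    define tiny where "tiny = {(u, v) \<in> good.
      card (Q (level u v) v) * 2 ^ (B * (3 * level u v + 8) + level u v + 4) \<le> n}"

    have bad_card: "real (card bad) \<le> n * n / 64"
    proof -
      \<comment> \<open>For fixed \<open>u\<close> and \<open>j\<close>, at most \<open>2^j\<close>
        heavy colours each give at most \<open>n / 2^(2 * j + 6)\<close> bad \<open>v\<close>.
        Summing \<open>n / 2^(j + 6)\<close> over \<open>u\<close> and \<open>j\<close> gives
        \<open>n * n / 64\<close>.\<close>
      define H where "H j u = {i\<in>M. n \<le> 2 ^ j * card (X i u)}" for j u
      define Z where "Z j u i = {v\<in>V. v \<in> N i u \<and> card (Q j v) < 2 ^ (j + 1) * card (Q j v - N i u)}" for j u i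
      have H: "finite (H j u)" "card (H j u) \<le> 2 ^ j" for j u
      proof -
        show fin: "finite (H j u)" using M by (simp add: H_def)
        show "card (H j u) \<le> 2 ^ j"
          by (rule card_heavy_colours[OF V(1) \<open>V \<noteq> {}\<close> fin disj[of u]]) (use X in \<open>auto simp: H_def n_def\<close>)
      qed
      have finZ: "finite (Z j u i)" for j u i
        using V by (simp add: Z_def)
      have Z: "card (Z j u i) * 2 ^ (2 * j + 6) \<le> n" if i: "i \<in> M" and u: "u \<in> V" for j u i
      proof -
        obtain U where "U \<subseteq> V" "\<forall>u\<in>U. \<forall>v\<in>V. cell j v = cell j u \<longrightarrow> v \<in> U"
          "2 ^ (3 * j + 8) * card (V \<inter> sym_diff (N i u) U) \<le> card V"
          using cell[OF NF[OF i u]] by metis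
        then show ?thesis
          unfolding Z_def Q_def n_def by (intro card_near_fibre_union[OF V(1), of U]) auto
      qed
      have "bad \<subseteq> (\<Union>j\<in>{1..n}. \<Union>u\<in>V. \<Union>i\<in>H j u. Pair u ` Z j u i)"
      proof clarify
        fix u v assume uv: "(u, v) \<in> bad"
        then have V': "u \<in> V" "v \<in> V" "u \<noteq> v" and le: "card (X (col u v) v) \<le> card (X (col u v) u)"
          by (auto simp: bad_def good_def)
        \<comment> \<open>Here the orientation enters: the level measures the class at
          \<open>v\<close>, but heaviness is needed at \<open>u\<close>.\<close>
        have "n \<le> 2 ^ level u v * card (X (col u v) u)"
          using level(2)[OF V'] le by (meson mult_le_mono2 order_trans)
        then have "col u v \<in> H (level u v) u"
          using col[OF V'] by (simp add: H_def)
        moreover have "v \<in> Z (level u v) u (col u v)"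
          using uv col[OF V'] V' by (auto simp: bad_def Z_def)
        ultimately show "(u, v) \<in> (\<Union>j\<in>{1..n}. \<Union>u\<in>V. \<Union>i\<in>H j u. Pair u ` Z j u i)"
          using level(1)[OF V'] V' by blast
      qed
      then have "card bad \<le> card (\<Union>j\<in>{1..n}. \<Union>u\<in>V. \<Union>i\<in>H j u. Pair u ` Z j u i)"
        by (rule card_mono[rotated]) (use H V finZ in auto)
      also have "\<dots> \<le> (\<Sum>j=1..n. card (\<Union>u\<in>V. \<Union>i\<in>H j u. Pair u ` Z j u i))"
        by (rule card_UN_le) simp
      also have "\<dots> \<le> (\<Sum>j=1..n. \<Sum>u\<in>V. card (\<Union>i\<in>H j u. Pair u ` Z j u i))"
        by (intro sum_mono card_UN_le V)
      also have "\<dots> \<le> (\<Sum>j=1..n. \<Sum>u\<in>V. \<Sum>i\<in>H j u. card (Pair u ` Z j u i))"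
        by (intro sum_mono card_UN_le H)
      also have "\<dots> = (\<Sum>j=1..n. \<Sum>u\<in>V. \<Sum>i\<in>H j u. card (Z j u i))"
        by (simp add: card_image inj_on_def)
      finally have "real (card bad) \<le> (\<Sum>j=1..n. \<Sum>u\<in>V. \<Sum>i\<in>H j u. real (card (Z j u i)))"
        by (simp only: of_nat_sum[symmetric] of_nat_le_iff)
      also have "\<dots> \<le> (\<Sum>j=1..n. \<Sum>u\<in>V. n / 2 ^ (j + 6))"
      proof (intro sum_mono)
        fix j u assume u: "u \<in> V"
        have "(\<Sum>i\<in>H j u. real (card (Z j u i))) \<le> card (H j u) * (n / 2 ^ (2 * j + 6))"
        proof (rule sum_bounded_above)
          fix i assume "i \<in> H j u"
          then have "real (card (Z j u i) * 2 ^ (2 * j + 6)) \<le> n"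
            using Z u of_nat_mono by (auto simp: H_def simp del: of_nat_mult)
          then show "real (card (Z j u i)) \<le> n / 2 ^ (2 * j + 6)"
            by (simp add: field_simps)
        qed
        also have "\<dots> \<le> 2 ^ j * (n / 2 ^ (2 * j + 6))"
          using of_nat_mono[OF H(2)[of j u], where 'a = real] by (intro mult_right_mono) auto
        also have "\<dots> = n / 2 ^ (j + 6)"
        proof -
          have "(2 :: real) ^ (2 * j + 6) = 2 ^ j * 2 ^ (j + 6)"
            by (simp flip: power_add)
          then show ?thesis
            by (simp only:) simp
        qed
        finally show "(\<Sum>i\<in>H j u. real (card (Z j u i))) \<le> n / 2 ^ (j + 6)" .
      qed
      also have "\<dots> = n * n / 64 * (\<Sum>j=1..n. 1 / 2 ^ j)"
        by (simp add: sum_distrib_left power_add n_def algebra_simps)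
      also have "\<dots> \<le> n * n / 64 * 1"
        by (intro mult_left_mono sum_half_powers) auto
      finally show ?thesis by simp
    qed

    have tiny_card: "real (card tiny) \<le> n * n / 16"
    proof -
      define Z where "Z j = {v\<in>V. card (Q j v) * 2 ^ (B * (3 * j + 8) + j + 4) \<le> n}" for j
      have finZ: "finite (Z j)" for j
        using V by (simp add: Z_def)
      have Z: "card (Z j) * 2 ^ (j + 4) \<le> n" for j
      proof -
        have "card (Z j) * 2 ^ (B * (3 * j + 8) + j + 4) \<le> card (cell j ` V) * n"
          by (rule card_small_fibres[OF V(1)]) (auto simp: Z_def Q_def)
        also have "\<dots> \<le> 2 ^ (B * (3 * j + 8)) * n"
          by (intro mult_le_mono1 card_cell)
        finally show ?thesis
          by (simp add: power_add)
      qed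
      have "tiny \<subseteq> (\<Union>j\<in>{1..n}. V \<times> Z j)"
      proof clarify
        fix u v assume uv: "(u, v) \<in> tiny"
        then have "u \<in> V" "v \<in> V" "u \<noteq> v"
          by (auto simp: tiny_def good_def)
        then show "(u, v) \<in> (\<Union>j\<in>{1..n}. V \<times> Z j)"
          using level(1)[of u v] uv by (auto simp: tiny_def Z_def)
      qed
      then have "card tiny \<le> card (\<Union>j\<in>{1..n}. V \<times> Z j)"
        by (rule card_mono[rotated]) (use V finZ in auto)
      also have "\<dots> \<le> (\<Sum>j=1..n. card (V \<times> Z j))"
        by (rule card_UN_le) simp
      finally have "real (card tiny) \<le> (\<Sum>j=1..n. real (card (V \<times> Z j)))"
        by (simp only: of_nat_sum[symmetric] of_nat_le_iff)
      also have "\<dots> \<le> (\<Sum>j=1..n. n * (n / 2 ^ (j + 4)))"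
      proof (intro sum_mono)
        fix j
        have "real (card (Z j)) * 2 ^ (j + 4) \<le> n"
          using of_nat_mono[OF Z[of j], where 'a = real] by simp
        then have "real n * real (card (Z j)) \<le> n * (n / 2 ^ (j + 4))"
          by (intro mult_left_mono) (auto simp: field_simps)
        then show "real (card (V \<times> Z j)) \<le> n * (n / 2 ^ (j + 4))"
          by (simp add: card_cartesian_product n_def)
      qed
      also have "\<dots> = n * n / 16 * (\<Sum>j=1..n. 1 / 2 ^ j)"
        by (simp add: sum_distrib_left power_add algebra_simps)
      also have "\<dots> \<le> n * n / 16 * 1"
        by (intro mult_left_mono sum_half_powers) auto
      finally show ?thesis by simp
    qed

    define rem where "rem = good - bad - tiny"
    \<comment> \<open>As \<open>n \<ge> 2\<close>, there are at least \<open>n * n / 4\<close> good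
      pairs, and 1/4 - 1/64 - 1/16 exceeds 1/8.\<close>
    have rem_card: "real (card rem) \<ge> n * n / 8"
    proof -
      have fin: "finite good"
        using V finite_subset[of good "V \<times> V"] by (auto simp: good_def)
      have "card good \<le> card rem + card bad + card tiny"
      proof -
        have "good \<subseteq> rem \<union> bad \<union> tiny" "finite rem" "finite bad" "finite tiny"
          using fin finite_subset[of bad good] finite_subset[of tiny good]
          by (auto simp: rem_def bad_def tiny_def)
        then have "card good \<le> card (rem \<union> bad \<union> tiny)"
          by (intro card_mono) auto
        also have "\<dots> \<le> card rem + card bad + card tiny"
          using card_Un_le[of "rem \<union> bad" tiny] card_Un_le[of rem bad] by linarith
        finally show ?thesis .
      qed
      moreover have "real (n * n) / 4 \<le> real (card good)"
      proof -
        have "2 * n \<le> n * n"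
          using n by simp
        then have "n * n \<le> 4 * card good"
          using good_card by linarith
        then have "real (n * n) \<le> real (4 * card good)"
          by (simp only: of_nat_le_iff)
        then show ?thesis by simp
      qed
      ultimately show ?thesis
        using bad_card tiny_card by (simp add: field_simps)
    qed
    have "\<exists>v\<in>V. real n / 8 \<le> card {u\<in>V. (u, v) \<in> rem}"
    proof (rule ccontr)
      assume *: "\<not> ?thesis"
      have "rem \<subseteq> (\<Union>v\<in>V. (\<lambda>u. (u, v)) ` {u\<in>V. (u, v) \<in> rem})"
        by (auto simp: rem_def good_def)
      then have "card rem \<le> card (\<Union>v\<in>V. (\<lambda>u. (u, v)) ` {u\<in>V. (u, v) \<in> rem})"
        by (rule card_mono[rotated]) (use V in auto)
      also have "\<dots> \<le> (\<Sum>v\<in>V. card ((\<lambda>u. (u, v)) ` {u\<in>V. (u, v) \<in> rem}))"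
        by (rule card_UN_le) (rule V)
      also have "\<dots> = (\<Sum>v\<in>V. card {u\<in>V. (u, v) \<in> rem})"
        by (intro sum.cong card_image) (auto simp: inj_on_def)
      finally have "real (card rem) \<le> (\<Sum>v\<in>V. real (card {u\<in>V. (u, v) \<in> rem}))"
        by (simp only: of_nat_sum[symmetric] of_nat_le_iff)
      also have "\<dots> < (\<Sum>v\<in>V. real n / 8)"
        using * V \<open>V \<noteq> {}\<close> by (intro sum_strict_mono) auto
      also have "\<dots> = real n * real n / 8"
        by (simp add: n_def)
      finally show False
        using rem_card by simp
    qed
    then obtain v where v: "v \<in> V" "real n / 8 \<le> card {u\<in>V. (u, v) \<in> rem}"
      by blast
    define R where "R j = {i\<in>M. \<exists>u\<in>V. (u, v) \<in> rem \<and> col u v = i \<and> level u v = j}" for j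
    have finR: "finite (R j)" for j
      using M by (simp add: R_def)
    have R: "\<exists>u. u \<in> V \<and> u \<noteq> v \<and> (u, v) \<in> rem \<and> col u v = i \<and> level u v = j" if "i \<in> R j" for i j
      using that by (auto simp: R_def rem_def good_def)
    have RX: "n \<le> 2 ^ j * card (X i v)" "2 ^ j * card (X i v) < 2 * n" if "i \<in> R j" for i j
      using R[OF that] level[OF _ v(1)] by auto
    \<comment> \<open>Otherwise the classes of all \<open>R j\<close>, each of size at most
      \<open>2 * n / 2^j\<close>, would cover fewer than \<open>n / 8\<close> vertices, since the
      sum of \<open>j / 2^j\<close> is at most 2.\<close>
    have "\<exists>j\<in>{1..n}. j \<le> 32 * card (R j)"
    proof (rule ccontr)
      assume *: "\<not> ?thesis"
      have "{u\<in>V. (u, v) \<in> rem} \<subseteq> (\<Union>j\<in>{1..n}. \<Union>i\<in>R j. X i v)"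
      proof clarify
        fix u assume u: "u \<in> V" "(u, v) \<in> rem"
        then have "u \<noteq> v"
          by (auto simp: rem_def good_def)
        then have "u \<in> X (col u v) v" "level u v \<in> {1..n}" "col u v \<in> R (level u v)"
          using u v col[of u v] level[of u v] col_commute[of u v] by (auto simp: X_def R_def)
        then show "u \<in> (\<Union>j\<in>{1..n}. \<Union>i\<in>R j. X i v)"
          by blast
      qed
      then have "card {u\<in>V. (u, v) \<in> rem} \<le> card (\<Union>j\<in>{1..n}. \<Union>i\<in>R j. X i v)"
        by (rule card_mono[rotated]) (use finR X in auto)
      also have "\<dots> \<le> (\<Sum>j=1..n. card (\<Union>i\<in>R j. X i v))"
        by (rule card_UN_le) simp
      also have "\<dots> \<le> (\<Sum>j=1..n. \<Sum>i\<in>R j. card (X i v))"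
        by (intro sum_mono card_UN_le finR)
      finally have "real (card {u\<in>V. (u, v) \<in> rem}) \<le> (\<Sum>j=1..n. \<Sum>i\<in>R j. real (card (X i v)))"
        by (simp only: of_nat_sum[symmetric] of_nat_le_iff)
      also have "\<dots> \<le> (\<Sum>j=1..n. card (R j) * (2 * n / 2 ^ j))"
      proof (intro sum_mono sum_bounded_above)
        fix j i assume "i \<in> R j"
        then have "real (2 ^ j * card (X i v)) \<le> real (2 * n)"
          using RX(2)[of i j] by (simp only: of_nat_le_iff less_imp_le)
        then show "real (card (X i v)) \<le> 2 * n / 2 ^ j"
          by (simp add: field_simps)
      qed
      also have "\<dots> < (\<Sum>j=1..n. j / 32 * (2 * n / 2 ^ j))"
      proof (intro sum_strict_mono mult_strict_right_mono)
        fix j assume "j \<in> {1..n}"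
        with * have "\<not> j \<le> 32 * card (R j)"
          by blast
        then have "real (32 * card (R j)) < real j"
          by (simp only: of_nat_less_iff not_le)
        then show "real (card (R j)) < j / 32"
          by simp
      qed (use n in auto)
      also have "\<dots> = n / 16 * (\<Sum>j=1..n. real j / 2 ^ j)"
        by (simp add: sum_distrib_left algebra_simps)
      also have "\<dots> \<le> n / 16 * 2"
        by (intro mult_left_mono sum_index_half_powers) auto
      finally show False
        using v(2) by simp
    qed
    then obtain j where j: "1 \<le> j" "j \<le> 32 * card (R j)"
      by auto
    then have "R j \<noteq> {}"
      by auto
    define U where "U i = (SOME u. u \<in> V \<and> u \<noteq> v \<and> (u, v) \<in> rem \<and> col u v = i \<and> level u v = j)" for i
    have U: "U i \<in> V \<and> U i \<noteq> v \<and> (U i, v) \<in> rem \<and> col (U i) v = i \<and> level (U i) v = j"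
      if "i \<in> R j" for i
      unfolding U_def by (rule someI_ex[OF R[OF that]])
    have missed: "2 ^ (j + 1) * card (Q j v - N i (U i)) \<le> card (Q j v)" if "i \<in> R j" for i
      using U[OF that] by (auto simp: rem_def bad_def)
    have large: "n \<le> card (Q j v) * 2 ^ (B * (3 * j + 8) + j + 4)"
    proof -
      obtain i where "i \<in> R j"
        using \<open>R j \<noteq> {}\<close> by blast
      from U[OF this] show ?thesis
        by (auto simp: rem_def tiny_def)
    qed
    define W where "W = {w\<in>V. \<forall>i\<in>R j. w \<in> N i (U i)}"
    have "card (R j) \<le> 2 ^ j"
      by (rule card_heavy_colours[OF V(1) \<open>V \<noteq> {}\<close> finR disj[of v]]) (use X RX in \<open>auto simp: n_def\<close>)
    \<comment> \<open>Union bound: at most \<open>2^j\<close> colours each miss at most a proportion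
      \<open>2^(-j-1)\<close> of the same cell, so half of it survives.\<close>
    have "2 * card (Q j v - W) \<le> card (Q j v)"
    proof -
      have "Q j v - W \<subseteq> (\<Union>i\<in>R j. Q j v - N i (U i))"
        by (auto simp: W_def Q_def)
      then have "card (Q j v - W) \<le> card (\<Union>i\<in>R j. Q j v - N i (U i))"
        by (rule card_mono[rotated]) (use finR finQ in auto)
      also have "\<dots> \<le> (\<Sum>i\<in>R j. card (Q j v - N i (U i)))"
        by (rule card_UN_le) (rule finR)
      finally have "2 ^ (j + 1) * card (Q j v - W) \<le> (\<Sum>i\<in>R j. 2 ^ (j + 1) * card (Q j v - N i (U i)))"
        by (metis mult_le_mono2 sum_distrib_left)
      also have "\<dots> \<le> card (R j) * card (Q j v)"
        using sum_bounded_above[of "R j" "\<lambda>i. 2 ^ (j + 1) * card (Q j v - N i (U i))" "card (Q j v)"]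
          missed by simp
      also have "\<dots> \<le> 2 ^ j * card (Q j v)"
        using \<open>card (R j) \<le> 2 ^ j\<close> by simp
      finally show ?thesis by simp
    qed
    moreover have "card (Q j v) \<le> card (Q j v - W) + card W"
    proof -
      have "card (Q j v) \<le> card ((Q j v - W) \<union> W)"
        using finQ V by (intro card_mono) (auto simp: W_def)
      then show ?thesis
        using card_Un_le[of "Q j v - W" W] by linarith
    qed
    ultimately have "card (Q j v) \<le> 2 * card W"
      by linarith
    then have "n \<le> 2 * card W * 2 ^ (B * (3 * j + 8) + j + 4)"
      using large by (meson mult_le_mono1 order_trans)
    also have "\<dots> = 2 ^ (B * (3 * j + 8) + j + 5) * card W"
      by (simp add: power_add)
    also have "\<dots> \<le> 2 ^ (C * card (R j)) * card W"
    proof (intro mult_le_mono1 power_increasing)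
      have "B * (3 * j + 8) + j + 5 \<le> B * (11 * j) + 6 * j"
        using j(1) mult_le_mono2[of "3 * j + 8" "11 * j" B] by linarith
      also have "\<dots> = (11 * B + 6) * j"
        by (simp add: algebra_simps)
      also have "\<dots> \<le> (11 * B + 6) * (32 * card (R j))"
        by (intro mult_le_mono2 j)
      finally show "B * (3 * j + 8) + j + 5 \<le> C * card (R j)"
        by (simp add: C_def algebra_simps)
    qed simp
    finally have "card V \<le> 2 ^ (C * card (R j)) * card {w\<in>V. \<forall>i\<in>R j. w \<in> N i (U i)}"
      by (simp add: n_def W_def)
    moreover have "R j \<subseteq> M" "\<forall>i\<in>R j. U i \<in> V"
      using U by (auto simp: R_def)
    ultimately show "\<exists>A U. A \<subseteq> M \<and> A \<noteq> {} \<and> (\<forall>i\<in>A. U i \<in> V) \<and>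
        card V \<le> 2 ^ (C * card A) * card {w\<in>V. \<forall>i\<in>A. w \<in> N i (U i)}"
      using \<open>R j \<noteq> {}\<close> by (intro exI[of _ "R j"] exI[of _ U] conjI)
  qed
qed

section \<open>Induction on clique numbers\<close>

text \<open>Passing to the common neighbourhood \<open>W\<close> decreases the clique number of each colour of \<open>A\<close>,
  and costs a factor \<open>2\<^sup>C\<close> per colour.\<close>

lemma card_le_of_clique_bounds:
  fixes K D :: nat
  shows "\<exists>C. \<forall>(F :: 'a set set) M (N :: 'c \<Rightarrow> 'a \<Rightarrow> 'a set) V q. poly_shatter K D F \<longrightarrow> finite M \<longrightarrow>
    (\<forall>i\<in>M. \<forall>u. N i u \<in> F \<and> u \<notin> N i u) \<longrightarrow>
    (\<forall>i\<in>M. \<forall>u v. v \<in> N i u \<longrightarrow> u \<in> N i v) \<longrightarrow> finite V \<longrightarrow>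
    (\<forall>u\<in>V. \<forall>v\<in>V. u \<noteq> v \<longrightarrow> (\<exists>i\<in>M. v \<in> N i u)) \<longrightarrow>
    (\<forall>i\<in>M. \<forall>S\<subseteq>V. (\<forall>x\<in>S. \<forall>y\<in>S. x \<noteq> y \<longrightarrow> y \<in> N i x) \<longrightarrow> card S \<le> q i + 1) \<longrightarrow>
    card V \<le> 2 ^ (C * sum q M)"
proof -
  obtain C where C: "\<forall>V (F :: 'a set set) M (N :: 'c \<Rightarrow> 'a \<Rightarrow> 'a set). finite V \<longrightarrow> card V \<ge> 2 \<longrightarrow> finite M \<longrightarrow>
    poly_shatter K D F \<longrightarrow> (\<forall>i\<in>M. \<forall>u\<in>V. N i u \<in> F) \<longrightarrow>
    (\<forall>i\<in>M. \<forall>u\<in>V. \<forall>v\<in>V. v \<in> N i u \<longrightarrow> u \<in> N i v) \<longrightarrow>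
    (\<forall>u\<in>V. \<forall>v\<in>V. u \<noteq> v \<longrightarrow> (\<exists>i\<in>M. v \<in> N i u)) \<longrightarrow>
    (\<exists>A U. A \<subseteq> M \<and> A \<noteq> {} \<and> (\<forall>i\<in>A. U i \<in> V) \<and>
      card V \<le> 2 ^ (C * card A) * card {w\<in>V. \<forall>i\<in>A. w \<in> N i (U i)})"
    by (rule large_common_neighbourhood[of K D, THEN exE])
  show ?thesis
  proof (intro exI[of _ C] allI impI)
    fix F :: "'a set set" and M and N :: "'c \<Rightarrow> 'a \<Rightarrow> 'a set" and V q
    assume F: "poly_shatter K D F" and M: "finite M"
      and N: "\<forall>i\<in>M. \<forall>u. N i u \<in> F \<and> u \<notin> N i u"
      and sym: "\<forall>i\<in>M. \<forall>u v. v \<in> N i u \<longrightarrow> u \<in> N i v"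
      and "finite V" and "\<forall>u\<in>V. \<forall>v\<in>V. u \<noteq> v \<longrightarrow> (\<exists>i\<in>M. v \<in> N i u)"
      and "\<forall>i\<in>M. \<forall>S\<subseteq>V. (\<forall>x\<in>S. \<forall>y\<in>S. x \<noteq> y \<longrightarrow> y \<in> N i x) \<longrightarrow> card S \<le> q i + 1"
    then show "card V \<le> 2 ^ (C * sum q M)"
    proof (induction "card V" arbitrary: V q rule: less_induct)
      case less
      note V = less.prems(5) and cover = less.prems(6) and clique = less.prems(7)
      show ?case
      proof (cases "card V \<ge> 2")
        case False
        then have "card V \<le> 1" by simp
        also have "(1 :: nat) \<le> 2 ^ (C * sum q M)" by simp
        finally show ?thesis .
      next
        case True
        have "\<exists>A U. A \<subseteq> M \<and> A \<noteq> {} \<and> (\<forall>i\<in>A. U i \<in> V) \<and>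
            card V \<le> 2 ^ (C * card A) * card {w\<in>V. \<forall>i\<in>A. w \<in> N i (U i)}"
          by (rule C[rule_format, OF V True M F]) (use N sym cover in auto)
        then obtain A U where A: "A \<subseteq> M" "A \<noteq> {}" and U: "\<forall>i\<in>A. U i \<in> V"
          and le: "card V \<le> 2 ^ (C * card A) * card {w\<in>V. \<forall>i\<in>A. w \<in> N i (U i)}"
          by (elim exE conjE)
        define W where "W = {w\<in>V. \<forall>i\<in>A. w \<in> N i (U i)}"
        have W: "W \<subseteq> V" "finite W"
          using V by (auto simp: W_def)
        have adj: "w \<in> N i (U i)" "U i \<in> N i w" "U i \<in> V" "U i \<noteq> w" if "i \<in> A" "w \<in> W" for i w
        proof -
          have "i \<in> M"
            using A that by blast
          show w: "w \<in> N i (U i)"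
            using that by (simp add: W_def)
          show "U i \<in> N i w"
            by (rule sym[rule_format, OF \<open>i \<in> M\<close> w])
          show "U i \<in> V"
            using U that by blast
          show "U i \<noteq> w"
            using N \<open>i \<in> M\<close> w by metis
        qed
        have "W \<noteq> {}"
          using le True unfolding W_def[symmetric] by auto
        then obtain w where w: "w \<in> W" by blast
        obtain i where "i \<in> A" using A by blast
        \<comment> \<open>No vertex is its own neighbour, so \<open>W\<close> is a proper subset and
          the induction applies.\<close>
        then have "U i \<in> V" "U i \<notin> W"
          using U adj(4)[of i "U i"] by auto
        then have less: "card W < card V"
          using W V by (intro psubset_card_mono) auto
        define q' where "q' i = (if i \<in> A then q i - 1 else q i)" for i
        \<comment> \<open>The pair \<open>{w, U i}\<close> is a clique of colour \<open>i\<close>,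
          so the truncated subtraction in \<open>q'\<close> really lowers
          \<open>q i\<close>.\<close>
        have pos: "q i \<ge> 1" if i: "i \<in> A" for i
        proof -
          have "card {w, U i} \<le> q i + 1"
            using clique A i adj[OF i w] W w by (intro clique[rule_format]) auto
          then show ?thesis
            using adj(4)[OF i w] by simp
        qed
        have "card W \<le> 2 ^ (C * sum q' M)"
        proof (rule less.hyps[OF less F M N sym W(2)])
          show "\<forall>u\<in>W. \<forall>v\<in>W. u \<noteq> v \<longrightarrow> (\<exists>i\<in>M. v \<in> N i u)"
            using cover W by blast
          show "\<forall>i\<in>M. \<forall>S\<subseteq>W. (\<forall>x\<in>S. \<forall>y\<in>S. x \<noteq> y \<longrightarrow> y \<in> N i x) \<longrightarrow> card S \<le> q' i + 1"
          proof (intro ballI allI impI)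
            fix i S assume i: "i \<in> M" and S: "S \<subseteq> W" "\<forall>x\<in>S. \<forall>y\<in>S. x \<noteq> y \<longrightarrow> y \<in> N i x"
            show "card S \<le> q' i + 1"
            proof (cases "i \<in> A")
              case True
              \<comment> \<open>Every vertex of \<open>W\<close> is joined to \<open>U i\<close> in
                colour \<open>i\<close>, so a clique inside \<open>W\<close> extends by one vertex
                of \<open>V\<close>.\<close>
              have "card (insert (U i) S) \<le> q i + 1"
              proof (rule clique[rule_format, OF i])
                show "insert (U i) S \<subseteq> V"
                  using S W U True by auto
                fix x y assume "x \<in> insert (U i) S" "y \<in> insert (U i) S" "x \<noteq> y"
                then show "y \<in> N i x"
                  using S adj[OF True] by blast
              qed
              moreover have "U i \<notin> S" "finite S"
                using S adj(4)[OF True] W finite_subset by auto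
              ultimately show ?thesis
                using True pos[OF True] by (simp add: q'_def)
            next
              case False
              then show ?thesis
                using clique i S W by (auto simp: q'_def)
            qed
          qed
        qed
        have "sum q M = sum q' M + card A"
        proof -
          have "sum q M = (\<Sum>i\<in>M. q' i + (if i \<in> A then 1 else 0))"
            using pos by (intro sum.cong) (auto simp: q'_def Suc_le_eq)
          also have "\<dots> = sum q' M + card A"
            using M A by (simp add: sum.distrib sum.If_cases Int_absorb1)
          finally show ?thesis .
        qed
        have "card V \<le> 2 ^ (C * card A) * card W"
          using le by (simp add: W_def)
        also have "\<dots> \<le> 2 ^ (C * card A) * 2 ^ (C * sum q' M)"
          by (intro mult_le_mono2) fact
        also have "\<dots> = 2 ^ (C * sum q M)"
          by (simp add: \<open>sum q M = _\<close> algebra_simps power_add)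
        finally show ?thesis .
      qed
    qed
  qed
qed

section \<open>Semi-algebraic neighbourhoods\<close>

definition exponents :: "nat \<Rightarrow> ('d::finite \<Rightarrow> nat) set" where
  "exponents T = UNIV \<rightarrow>\<^sub>E {..T}"

definition monomial_fun :: "('d::finite \<Rightarrow> nat) \<Rightarrow> real^'d \<Rightarrow> real" where
  "monomial_fun e v = (\<Prod>i\<in>UNIV. (v $ i) ^ e i)"

text \<open>Each exponent is bounded separately; the span contains all polynomials of total degree
  at most \<open>T\<close>.\<close>

definition poly_fun :: "nat \<Rightarrow> (real^'d::finite \<Rightarrow> real) \<Rightarrow> bool" where
  "poly_fun T f \<longleftrightarrow> (\<exists>c. \<forall>v. f v = (\<Sum>e\<in>exponents T. c e * monomial_fun e v))"

lemma finite_exponents: "finite (exponents T)"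
  by (auto simp: exponents_def intro: finite_PiE)

lemma poly_fun_monomial:
  assumes "\<And>i. e i \<le> T"
  shows "poly_fun T (\<lambda>v. c * monomial_fun e v)"
proof -
  have "e \<in> exponents T"
    using assms by (simp add: exponents_def PiE_UNIV_domain)
  then have "c * monomial_fun e v = (\<Sum>e'\<in>exponents T. (if e' = e then c else 0) * monomial_fun e' v)" for v
    by (simp add: finite_exponents if_distrib[of "\<lambda>x. x * _"] cong: if_cong)
  then show ?thesis
    unfolding poly_fun_def by (intro exI allI)
qed

lemma poly_fun_add:
  assumes "poly_fun T f" "poly_fun T g"
  shows "poly_fun T (\<lambda>v. f v + g v)"
proof -
  obtain c c' where c: "\<forall>v. f v = (\<Sum>e\<in>exponents T. c e * monomial_fun e v)"
    "\<forall>v. g v = (\<Sum>e\<in>exponents T. c' e * monomial_fun e v)"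
    using assms unfolding poly_fun_def by blast
  have "f v + g v = (\<Sum>e\<in>exponents T. (c e + c' e) * monomial_fun e v)" for v
    by (simp add: c sum.distrib distrib_right)
  then show ?thesis
    unfolding poly_fun_def by (intro exI allI)
qed

lemma poly_fun_sum:
  assumes "\<And>a. a \<in> A \<Longrightarrow> poly_fun T (f a)"
  shows "poly_fun T (\<lambda>v. \<Sum>a\<in>A. f a v)"
  using assms
proof (induction A rule: infinite_finite_induct)
  case (insert a A)
  then show ?case
    using poly_fun_add[of T "f a" "\<lambda>v. \<Sum>a\<in>A. f a v"] by simp
qed (use poly_fun_monomial[of "\<lambda>_. 0" T 0] in simp_all)

lemma poly_fun_power:
  assumes "r \<le> T"
  shows "poly_fun T (\<lambda>v. c * (v $ i) ^ r)"
proof -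
  let ?e = "\<lambda>k. if k = i then r else 0"
  have "monomial_fun ?e v = (\<Prod>k\<in>UNIV. if k = i then (v $ k) ^ r else 1)" for v
    unfolding monomial_fun_def by (rule prod.cong) auto
  then have "monomial_fun ?e v = (v $ i) ^ r" for v
    by simp
  then show ?thesis
    using poly_fun_monomial[of ?e T c] assms by simp
qed

text \<open>Expanding the squares leaves coefficients that depend on \<open>u\<close> only; the
  bound \<open>t + 2\<close> admits squares for every \<open>t\<close>.\<close>

lemma poly_fun_neg_dist_square: "poly_fun (t + 2) (\<lambda>v. - (\<Sum>i\<in>UNIV. (v $ i - u $ i) ^ 2))"
proof -
  have "- (\<Sum>i\<in>UNIV. (v $ i - u $ i) ^ 2) =
      (\<Sum>i\<in>UNIV. (-1) * (v $ i) ^ 2 + (2 * u $ i * (v $ i) ^ 1 + (- ((u $ i) ^ 2)) * (v $ i) ^ 0))" for v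
    by (subst sum_negf[symmetric], intro sum.cong) (auto simp: power2_eq_square algebra_simps)
  moreover have "poly_fun (t + 2) (\<lambda>v. \<Sum>i\<in>UNIV. (-1) * (v $ i) ^ 2 +
      (2 * u $ i * (v $ i) ^ 1 + (- ((u $ i) ^ 2)) * (v $ i) ^ 0))"
    by (intro poly_fun_sum poly_fun_add poly_fun_power) auto
  ultimately show ?thesis by simp
qed

lemma exponent_le_total_degree:
  assumes "a \<in> Poly_Mapping.keys g"
  shows "Poly_Mapping.lookup a i \<le> total_degree g"
proof (cases "i \<in> Poly_Mapping.keys a")
  case True
  then have "Poly_Mapping.lookup a i \<le> (\<Sum>i\<in>Poly_Mapping.keys a. Poly_Mapping.lookup a i)"
    by (intro member_le_sum) auto
  also have "\<dots> \<le> total_degree g"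
    unfolding total_degree_def using assms by (intro Max_ge) auto
  finally show ?thesis .
qed (simp add: in_keys_iff)

text \<open>For fixed \<open>u\<close> each monomial in both points splits into a constant and a
  monomial in \<open>v\<close>. Hence all neighbourhoods, for all polynomials and all
  \<open>u\<close>, use one span.\<close>

lemma poly_fun_eval_pair:
  assumes "total_degree g \<le> T"
  shows "poly_fun T (eval_pair g u)"
proof -
  let ?p = "\<lambda>v. case_sum (\<lambda>i. u $ i) (\<lambda>i. v $ i)"
  have split: "(\<Prod>i\<in>Poly_Mapping.keys a. ?p v i ^ Poly_Mapping.lookup a i) =
      (\<Prod>i\<in>UNIV. (u $ i) ^ Poly_Mapping.lookup a (Inl i)) *
      monomial_fun (\<lambda>i. Poly_Mapping.lookup a (Inr i)) v" for a v
  proof -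
    have "(\<Prod>i\<in>Poly_Mapping.keys a. ?p v i ^ Poly_Mapping.lookup a i) =
        (\<Prod>i\<in>UNIV <+> UNIV. ?p v i ^ Poly_Mapping.lookup a i)"
      by (rule prod.mono_neutral_left) (auto simp: in_keys_iff)
    then show ?thesis
      by (simp add: prod.Plus monomial_fun_def del: UNIV_Plus_UNIV)
  qed
  have "eval_pair g u = (\<lambda>v. \<Sum>a\<in>Poly_Mapping.keys g.
      (Poly_Mapping.lookup g a * (\<Prod>i\<in>UNIV. (u $ i) ^ Poly_Mapping.lookup a (Inl i))) *
      monomial_fun (\<lambda>i. Poly_Mapping.lookup a (Inr i)) v)"
    by (simp add: fun_eq_iff eval_pair_def eval_mpoly_def split mult.assoc)
  moreover have "Poly_Mapping.lookup a i \<le> T" if "a \<in> Poly_Mapping.keys g" for a i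
    using exponent_le_total_degree[OF that] assms by (rule order_trans)
  then have "poly_fun T (\<lambda>v. \<Sum>a\<in>Poly_Mapping.keys g.
      (Poly_Mapping.lookup g a * (\<Prod>i\<in>UNIV. (u $ i) ^ Poly_Mapping.lookup a (Inl i))) *
      monomial_fun (\<lambda>i. Poly_Mapping.lookup a (Inr i)) v)"
    by (intro poly_fun_sum poly_fun_monomial)
  ultimately show ?thesis by simp
qed

lemma eval_formula_cong:
  "(\<And>a. a \<in> atoms \<phi> \<Longrightarrow> \<sigma> a = \<tau> a) \<Longrightarrow> eval_formula \<phi> \<sigma> = eval_formula \<phi> \<tau>"
  by (induction \<phi>) auto

text \<open>The condition \<open>v \<noteq> u\<close> is expressed by the sign of the polynomial \<open>- \<bar>v - u\<bar>\<^sup>2\<close>, which gets index \<open>t\<close>.\<close>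

lemma neighbourhood_in_sign_sets:
  fixes u :: "real^'d::finite"
  assumes len: "length gs \<le> t" and deg: "\<forall>g\<in>set gs. total_degree g \<le> t"
    and \<Phi>: "atoms \<Phi> \<subseteq> {..<length gs}"
  shows "{v. v \<noteq> u \<and> sign_relation gs \<Phi> u v} \<in> sign_sets (t + 1) (exponents (t + 2)) monomial_fun"
proof -
  \<comment> \<open>Since \<open>length gs \<le> t\<close>, index \<open>t\<close> always carries
    the distance polynomial. So do any indices from \<open>length gs\<close> up to \<open>t\<close>,
    but the atoms of \<open>\<Phi>\<close> do not reach them.\<close>
  define f where "f l = (if l < length gs then eval_pair (gs ! l) u
    else (\<lambda>v. - (\<Sum>i\<in>UNIV. (v $ i - u $ i) ^ 2)))" for l
  have "poly_fun (t + 2) (f l)" for l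
  proof (cases "l < length gs")
    case True
    then have "total_degree (gs ! l) \<le> t + 2"
      using deg by (meson nth_mem trans_le_add1)
    with True show ?thesis
      by (simp add: f_def poly_fun_eval_pair)
  next
    case False
    then show ?thesis
      using poly_fun_neg_dist_square[of t u] by (simp add: f_def)
  qed
  then have "\<forall>l. \<exists>c. \<forall>v. f l v = (\<Sum>e\<in>exponents (t + 2). c e * monomial_fun e v)"
    by (simp add: poly_fun_def)
  then obtain c where c: "\<forall>l. \<forall>v. f l v = (\<Sum>e\<in>exponents (t + 2). c l e * monomial_fun e v)"
    by (rule choice[THEN exE])
  define \<Psi> where "\<Psi> = {L. t \<notin> L \<and> eval_formula \<Phi> (\<lambda>l. l \<in> L)}"
  have "v \<noteq> u \<and> sign_relation gs \<Phi> u v \<longleftrightarrow> {l\<in>{..<t + 1}. f l v \<ge> 0} \<in> \<Psi>" for v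
  proof -
    have "f t v \<ge> 0 \<longleftrightarrow> v = u"
    proof -
      have "f t v = - (\<Sum>i\<in>UNIV. (v $ i - u $ i) ^ 2)"
        using len by (simp add: f_def)
      moreover have "(\<Sum>i\<in>UNIV. (v $ i - u $ i) ^ 2) \<le> 0 \<longleftrightarrow> (\<Sum>i\<in>UNIV. (v $ i - u $ i) ^ 2) = 0"
        using sum_nonneg[of UNIV "\<lambda>i. (v $ i - u $ i) ^ 2"] by auto
      ultimately show ?thesis
        by (simp add: sum_nonneg_eq_0_iff vec_eq_iff)
    qed
    moreover have "sign_relation gs \<Phi> u v = eval_formula \<Phi> (\<lambda>l. l \<in> {l\<in>{..<t + 1}. f l v \<ge> 0})"
      unfolding sign_relation_def using \<Phi> len by (intro eval_formula_cong) (auto simp: f_def)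
    ultimately show ?thesis
      by (auto simp: \<Psi>_def)
  qed
  then have "{v. v \<noteq> u \<and> sign_relation gs \<Phi> u v} =
      {v. {l\<in>{..<t + 1}. (\<Sum>e\<in>exponents (t + 2). c l e * monomial_fun e v) \<ge> 0} \<in> \<Psi>}"
    by (simp add: c)
  then show ?thesis
    unfolding sign_sets_def by blast
qed

text \<open>Without a clique of size \<open>p\<close> every colour has clique number at most
  \<open>p - 1\<close>. The clique bound with \<open>q i = p - 2\<close> then gives at most
  \<open>2^(C * (p - 2) * m)\<close> vertices, one fewer than assumed.\<close>

lemma semialgebraic_arrow_exponential:
  assumes "p \<ge> 2"
  shows "\<exists>C. \<forall>m. semialgebraic_arrow TYPE('d::finite) t p m (2 ^ (C * m) + 1)"
proof -
  obtain K D where KD: "poly_shatter K D (sign_sets (t + 1) (exponents (t + 2)) (monomial_fun :: _ \<Rightarrow> real^'d \<Rightarrow> _))"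
    using poly_shatter_sign_sets[OF finite_exponents] by blast
  obtain C where C: "\<forall>(F :: (real^'d) set set) M (N :: nat \<Rightarrow> real^'d \<Rightarrow> (real^'d) set) V q.
    poly_shatter K D F \<longrightarrow> finite M \<longrightarrow>
    (\<forall>i\<in>M. \<forall>u. N i u \<in> F \<and> u \<notin> N i u) \<longrightarrow>
    (\<forall>i\<in>M. \<forall>u v. v \<in> N i u \<longrightarrow> u \<in> N i v) \<longrightarrow> finite V \<longrightarrow>
    (\<forall>u\<in>V. \<forall>v\<in>V. u \<noteq> v \<longrightarrow> (\<exists>i\<in>M. v \<in> N i u)) \<longrightarrow>
    (\<forall>i\<in>M. \<forall>S\<subseteq>V. (\<forall>x\<in>S. \<forall>y\<in>S. x \<noteq> y \<longrightarrow> y \<in> N i x) \<longrightarrow> card S \<le> q i + 1) \<longrightarrow>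
    card V \<le> 2 ^ (C * sum q M)"
    by (rule card_le_of_clique_bounds[of K D, THEN exE])
  have "semialgebraic_arrow TYPE('d) t p m (2 ^ (C * (p - 2) * m) + 1)" for m
    unfolding semialgebraic_arrow_def
  proof (intro allI impI, rule ccontr)
    fix V :: "(real^'d) set" and E :: "nat \<Rightarrow> (real^'d) set set"
    assume V: "finite V" "card V = 2 ^ (C * (p - 2) * m) + 1"
      and "\<forall>k\<in>{1..m}. semialgebraic_relation t V (E k)"
      and union: "(\<Union>k\<in>{1..m}. E k) = [V]\<^bsup>2\<^esup>"
      and none: "\<not> (\<exists>S k. S \<subseteq> V \<and> card S = p \<and> k \<in> {1..m} \<and> [S]\<^bsup>2\<^esup> \<subseteq> E k)"
    then have "\<forall>k\<in>{1..m}. \<exists>y. length (fst y) \<le> t \<and> (\<forall>g\<in>set (fst y). total_degree g \<le> t) \<and>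
      atoms (snd y) \<subseteq> {..<length (fst y)} \<and>
      (\<forall>u v. sign_relation (fst y) (snd y) u v \<longleftrightarrow> sign_relation (fst y) (snd y) v u) \<and>
      (\<forall>u\<in>V. \<forall>v\<in>V. u \<noteq> v \<longrightarrow> ({u, v} \<in> E k \<longleftrightarrow> sign_relation (fst y) (snd y) u v))"
      by (simp add: semialgebraic_relation_def)
    then obtain y where y: "\<forall>k\<in>{1..m}. length (fst (y k)) \<le> t \<and>
      (\<forall>g\<in>set (fst (y k)). total_degree g \<le> t) \<and>
      atoms (snd (y k)) \<subseteq> {..<length (fst (y k))} \<and>
      (\<forall>u v. sign_relation (fst (y k)) (snd (y k)) u v \<longleftrightarrow> sign_relation (fst (y k)) (snd (y k)) v u) \<and>
      (\<forall>u\<in>V. \<forall>v\<in>V. u \<noteq> v \<longrightarrow> ({u, v} \<in> E k \<longleftrightarrow> sign_relation (fst (y k)) (snd (y k)) u v))"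
      by (rule bchoice[THEN exE])
    \<comment> \<open>The neighbourhoods live in the whole space, where the relations are symmetric;
      removing \<open>u\<close> excludes loops even if the relation holds at
      \<open>(u, u)\<close>.\<close>
    define N where "N k u = {v. v \<noteq> u \<and> sign_relation (fst (y k)) (snd (y k)) u v}" for k u
    have N: "v \<in> N k u \<longleftrightarrow> u \<noteq> v \<and> {u, v} \<in> E k" if "k \<in> {1..m}" "u \<in> V" "v \<in> V" for k u v
      using y that by (auto simp: N_def)
    have "card V \<le> 2 ^ (C * (\<Sum>k=1..m. p - 2))"
    proof (rule C[rule_format, OF KD])
      show "N k u \<in> sign_sets (t + 1) (exponents (t + 2)) monomial_fun \<and> u \<notin> N k u"
        if "k \<in> {1..m}" for k u
        unfolding N_def using y that by (intro conjI neighbourhood_in_sign_sets) auto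
      show "u \<in> N k v" if "k \<in> {1..m}" "v \<in> N k u" for k u v
        using y that unfolding N_def by blast
      show "\<exists>k\<in>{1..m}. v \<in> N k u" if "u \<in> V" "v \<in> V" "u \<noteq> v" for u v
      proof -
        have "{u, v} \<in> [V]\<^bsup>2\<^esup>"
          using that by (simp add: nsets_def)
        then show ?thesis
          using union N that by blast
      qed
      show "card S \<le> p - 2 + 1"
        if k: "k \<in> {1..m}" and S: "S \<subseteq> V" and clique: "\<And>x y. x \<in> S \<Longrightarrow> y \<in> S \<Longrightarrow> x \<noteq> y \<Longrightarrow> y \<in> N k x" for k S
      proof (rule ccontr)
        assume "\<not> ?thesis"
        then have "p \<le> card S"
          using assms by linarith
        then obtain S' where S': "S' \<subseteq> S" "card S' = p"
          by (rule obtain_subset_with_card_n)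
        have "[S']\<^bsup>2\<^esup> \<subseteq> E k"
        proof
          fix X assume "X \<in> [S']\<^bsup>2\<^esup>"
          then obtain x y where "X = {x, y}" "x \<noteq> y" "x \<in> S'" "y \<in> S'"
            by (auto simp: nsets_def card_2_iff)
          then show "X \<in> E k"
            using clique S S' N[OF k] by blast
        qed
        then show False
          using none S S' k by blast
      qed
    qed (use V in auto)
    then show False
      using V by (simp add: algebra_simps)
  qed
  then show ?thesis by blast
qed

theorem theorem1p1:
  fixes t p :: nat
  assumes "t \<ge> 1" and "p \<ge> 3"
  shows "\<exists>C::real. \<forall>m\<ge>1.
    real (semialgebraic_ramsey TYPE('d::finite) t p m) \<le> 2 powr (C * real m)"
proof -
  obtain C where C: "\<And>m. semialgebraic_arrow TYPE('d) t p m (2 ^ (C * m) + 1)"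
    using semialgebraic_arrow_exponential[of p] assms by auto
  have "real (semialgebraic_ramsey TYPE('d) t p m) \<le> 2 powr (real (C + 1) * real m)" if "m \<ge> 1" for m
  proof -
    have "semialgebraic_ramsey TYPE('d) t p m \<le> 2 ^ (C * m) + 1"
      unfolding semialgebraic_ramsey_def by (rule Least_le) (rule C)
    \<comment> \<open>The additive 1 costs one more factor 2, absorbed into the exponent because
      \<open>m \<ge> 1\<close>.\<close>
    also have "\<dots> \<le> 2 ^ (C * m) + 2 ^ (C * m)"
      by simp
    also have "\<dots> = 2 ^ (C * m + 1)"
      by simp
    also have "\<dots> \<le> 2 ^ ((C + 1) * m)"
      using that by (intro power_increasing) auto
    finally have "real (semialgebraic_ramsey TYPE('d) t p m) \<le> real (2 ^ ((C + 1) * m))"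
      by (simp only: of_nat_le_iff)
    also have "\<dots> = 2 powr (real (C + 1) * real m)"
      by (simp add: powr_realpow[symmetric] algebra_simps)
    finally show ?thesis .
  qed
  then show ?thesis by blast
qed

end
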